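(* Let $\mathsf{V}$ be a unit-closed variety of non-associative algebras over a field $\mathbb{F}$ and let $\mathsf{V}_1$ be the category of unital algebras of $\mathsf{V}$. The ideally exact context $F\dashv U$, where $U\colon\mathsf{V}_1\to\mathsf{V}$ is the forgetful functor and $F(X)=\mathbb{F}\ltimes X$, is BAT.
   Context: A non-associative algebra over $\mathbb{F}$ is a vector space with a bilinear multiplication; morphisms are linear maps preserving multiplication. A variety of non-associative algebras is the class of all algebras satisfying a given set of identities (non-associative polynomials $\varphi(x_1,\dots,x_n)$ required to vanish on all elements), viewed as a full subcategory; it is a semi-abelian category. $\mathsf{V}$ is unit-closed if for any $X$ in $\mathsf{V}$ the algebra obtained by adjoining to $X$ an external element $1$ with $x\cdot1=1\cdot x=x$ is still in $\mathsf{V}$. $\mathsf{V}_1$ has as objects the unital algebras of $\mathsf{V}$ and as morphisms the algebra morphisms preserving units. The left adjoint $F$ of $U$ sends $X$ to $\mathbb{F}\ltimes X$ with multiplication $(\alpha,x)(\alpha',x')=(\alpha\alpha',xx'+\alpha x'+\alpha'x)$ and unit $(1,0_X)$, with unit of adjunction $\eta_X(x)=(0,x)$. This adjunction is an ideally exact context: a monadic adjunction $F\dashv U$, $U\colon\mathsf{U}\to\mathsf{V}$, with $\mathsf{U}$ ideally exact (Barr-exact, protomodular, finite coproducts, initial-to-terminal morphism a regular epimorphism), $\mathsf{V}$ semi-abelian and cartesian unit; here $\mathsf{U}=\mathsf{V}_1$. $F(0)=\mathbb{F}$ is initial in $\mathsf{U}$; write $\iota_B\colon F(0)\to B$ for the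 unique morphism in $\mathsf{U}$, and $\tau_X\colon X\to0$, $\iota_X\colon0\to X$ in $\mathsf{V}$. Internal actions in $\mathsf{V}$: $\kappa_{C,X}\colon C\flat X\to C+X$ denotes a kernel of $[\mathrm{id}_C,0]\colon C+X\to C$ ($+$ is coproduct in $\mathsf{V}$). $C\flat(-)$ is a monad on $\mathsf{V}$ (unit $u_X$ with $\kappa_{C,X}u_X=i_2$, multiplication $\mu_X$ with $\kappa_{C,X}\mu_X=[i_1,\kappa_{C,X}]\kappa_{C,C\flat X}$); an internal action of $C$ on $X$ is an algebra $\xi\colon C\flat X\to X$. For $g\colon C\to D$, $g\flat\mathrm{id}_X$ is the unique morphism with $\kappa_{D,X}(g\flat\mathrm{id}_X)=(g+\mathrm{id}_X)\kappa_{C,X}$. A point over $C$ (split epimorphism $p\colon A\to C$ with chosen section $s$) is associated with $\xi$ if there is a kernel $k\colon X\to A$ of $p$ with $k\xi=[s,k]\kappa_{C,X}$; this gives an equivalence between points over $C$ and internal actions of $C$. A relative $U$-action of $B\in\mathsf{U}$ on $X\in\mathsf{V}$ is an internal action $\xi\colon U(B)\flat X\to X$. $\xi_0\colon UF(0)\flat X\to X$ is the action with $\eta_X\xi_0=[UF(\iota_X),\eta_X]\kappa_{UF(0),X}$ (associated with the point $(UF(\tau_X),UF(\iota_X))$ with kernel $\eta_X$). $\xi$ is coherent if $\xi\circ(U(\iota_B)\flat\mathrm{id}_X)=\xi_0$. A point $(p\colon A\to U(B),s)$ in $\mathsf{V}$ is ideal if there exist a point $(p'\colon A'\to B,s')$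 in $\mathsf{U}$ and an isomorphism $\sigma\colon U(A')\to A$ with $p\sigma=U(p')$, $\sigma U(s')=s$; a relative $U$-action is ideal if any associated point is ideal. A morphism $h\colon A_1\to A_2$ of ideal points $(p_i\colon A_i\to U(B),s_i)$, $i=1,2$, over $U(B)$ (commuting with retractions and sections) is ideal if there is a morphism $h'\colon A_1'\to A_2'$ of points over $B$ in $\mathsf{U}$ between corresponding points $(p_i'\colon A_i'\to B,s_i')$ (with isomorphisms $\sigma_i\colon U(A_i')\to A_i$ satisfying $p_i\sigma_i=U(p_i')$ and $\sigma_iU(s_i')=s_i$) such that $h\sigma_1=\sigma_2U(h')$; a morphism of ideal actions of the same $B$ is ideal if the corresponding morphism of points is. The ideally exact context is BAT if all coherent actions are ideal and all morphisms of such actions are ideal. *)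

theory Defs
  imports "HOL-Algebra.Module" "HOL-Library.FuncSet"
begin

section \<open>Categories, limits and colimits\<close>

record ('o, 'm) category =
  Obj :: "'o set"
  Arr :: "'m set"
  Dom :: "'m \<Rightarrow> 'o"
  Cod :: "'m \<Rightarrow> 'o"
  Idt :: "'o \<Rightarrow> 'm"
  Cmp :: "'m \<Rightarrow> 'm \<Rightarrow> 'm"  (infixr \<open>\<cdot>\<index>\<close> 75)

definition Hom :: "('o, 'm) category \<Rightarrow> 'o \<Rightarrow> 'o \<Rightarrow> 'm set" where
  "Hom C A B = {f \<in> Arr C. Dom C f = A \<and> Cod C f = B}"

definition is_iso :: "('o, 'm) category \<Rightarrow> 'm \<Rightarrow> bool" where
  "is_iso C f \<longleftrightarrow> f \<in> Arr C \<and>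
     (\<exists>g \<in> Hom C (Cod C f) (Dom C f). g \<cdot>\<^bsub>C\<^esub> f = Idt C (Dom C f) \<and> f \<cdot>\<^bsub>C\<^esub> g = Idt C (Cod C f))"

definition zero_object :: "('o, 'm) category \<Rightarrow> 'o \<Rightarrow> bool" where
  "zero_object C Z \<longleftrightarrow> Z \<in> Obj C \<and>
     (\<forall>A \<in> Obj C. (\<exists>!f. f \<in> Hom C Z A) \<and> (\<exists>!f. f \<in> Hom C A Z))"

definition unique_arr :: "('o, 'm) category \<Rightarrow> 'o \<Rightarrow> 'o \<Rightarrow> 'm" where
  "unique_arr C A B = (THE f. f \<in> Hom C A B)"

definition zero_arr :: "('o, 'm) category \<Rightarrow> 'o \<Rightarrow> 'o \<Rightarrow> 'o \<Rightarrow> 'm" where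
  "zero_arr C Z A B = unique_arr C Z B \<cdot>\<^bsub>C\<^esub> unique_arr C A Z"

definition is_kernel :: "('o, 'm) category \<Rightarrow> 'o \<Rightarrow> 'o \<Rightarrow> 'm \<Rightarrow> 'm \<Rightarrow> bool" where
  "is_kernel C Z N k p \<longleftrightarrow>
     N \<in> Obj C \<and> p \<in> Arr C \<and> k \<in> Hom C N (Dom C p) \<and>
     p \<cdot>\<^bsub>C\<^esub> k = zero_arr C Z N (Cod C p) \<and>
     (\<forall>W \<in> Obj C. \<forall>f \<in> Hom C W (Dom C p). p \<cdot>\<^bsub>C\<^esub> f = zero_arr C Z W (Cod C p) \<longrightarrow>
        (\<exists>!g. g \<in> Hom C W N \<and> k \<cdot>\<^bsub>C\<^esub> g = f))"

definition is_coproduct :: "('o, 'm) category \<Rightarrow> 'o \<Rightarrow> 'o \<Rightarrow> 'o \<Rightarrow> 'm \<Rightarrow> 'm \<Rightarrow> bool" where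
  "is_coproduct C A B P i j \<longleftrightarrow>
     P \<in> Obj C \<and> i \<in> Hom C A P \<and> j \<in> Hom C B P \<and>
     (\<forall>W \<in> Obj C. \<forall>f \<in> Hom C A W. \<forall>g \<in> Hom C B W.
        \<exists>!h. h \<in> Hom C P W \<and> h \<cdot>\<^bsub>C\<^esub> i = f \<and> h \<cdot>\<^bsub>C\<^esub> j = g)"


section \<open>Internal actions and points\<close>

text \<open>A choice of a zero object, of binary coproducts \<open>C + X\<close> with injections, and of kernels
  \<open>\<kappa>\<^bsub>C,X\<^esub>: C\<flat>X \<rightarrow> C + X\<close> of \<open>[id, 0]: C + X \<rightarrow> C\<close>.\<close>

record ('o, 'm) choice =
  zob :: "'o"
  cop :: "'o \<Rightarrow> 'o \<Rightarrow> 'o"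
  in1 :: "'o \<Rightarrow> 'o \<Rightarrow> 'm"
  in2 :: "'o \<Rightarrow> 'o \<Rightarrow> 'm"
  flat :: "'o \<Rightarrow> 'o \<Rightarrow> 'o"
  kap :: "'o \<Rightarrow> 'o \<Rightarrow> 'm"

definition copair :: "('o, 'm) category \<Rightarrow> ('o, 'm) choice \<Rightarrow> 'm \<Rightarrow> 'm \<Rightarrow> 'm" where
  "copair C S f g = (THE h. h \<in> Hom C (cop S (Dom C f) (Dom C g)) (Cod C f) \<and>
     h \<cdot>\<^bsub>C\<^esub> in1 S (Dom C f) (Dom C g) = f \<and> h \<cdot>\<^bsub>C\<^esub> in2 S (Dom C f) (Dom C g) = g)"

definition cop_map :: "('o, 'm) category \<Rightarrow> ('o, 'm) choice \<Rightarrow> 'm \<Rightarrow> 'm \<Rightarrow> 'm" where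
  "cop_map C S f g = copair C S (in1 S (Cod C f) (Cod C g) \<cdot>\<^bsub>C\<^esub> f) (in2 S (Cod C f) (Cod C g) \<cdot>\<^bsub>C\<^esub> g)"

definition is_choice :: "('o, 'm) category \<Rightarrow> ('o, 'm) choice \<Rightarrow> bool" where
  "is_choice V S \<longleftrightarrow> zero_object V (zob S) \<and>
     (\<forall>C \<in> Obj V. \<forall>X \<in> Obj V.
        is_coproduct V C X (cop S C X) (in1 S C X) (in2 S C X) \<and>
        is_kernel V (zob S) (flat S C X) (kap S C X) (copair V S (Idt V C) (zero_arr V (zob S) X C)))"

definition flat_unit :: "('o, 'm) category \<Rightarrow> ('o, 'm) choice \<Rightarrow> 'o \<Rightarrow> 'o \<Rightarrow> 'm" where
  "flat_unit V S C X = (THE u. u \<in> Hom V X (flat S C X) \<and> kap S C X \<cdot>\<^bsub>V\<^esub> u = in2 S C X)"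

definition flat_mult :: "('o, 'm) category \<Rightarrow> ('o, 'm) choice \<Rightarrow> 'o \<Rightarrow> 'o \<Rightarrow> 'm" where
  "flat_mult V S C X = (THE m. m \<in> Hom V (flat S C (flat S C X)) (flat S C X) \<and>
     kap S C X \<cdot>\<^bsub>V\<^esub> m = copair V S (in1 S C X) (kap S C X) \<cdot>\<^bsub>V\<^esub> kap S C (flat S C X))"

definition flat_map :: "('o, 'm) category \<Rightarrow> ('o, 'm) choice \<Rightarrow> 'm \<Rightarrow> 'm \<Rightarrow> 'm" where
  "flat_map V S g f = (THE m. m \<in> Hom V (flat S (Dom V g) (Dom V f)) (flat S (Cod V g) (Cod V f)) \<and>
     kap S (Cod V g) (Cod V f) \<cdot>\<^bsub>V\<^esub> m = cop_map V S g f \<cdot>\<^bsub>V\<^esub> kap S (Dom V g) (Dom V f))"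

definition internal_action ::
  "('o, 'm) category \<Rightarrow> ('o, 'm) choice \<Rightarrow> 'o \<Rightarrow> 'o \<Rightarrow> 'm \<Rightarrow> bool" where
  "internal_action V S C X \<xi> \<longleftrightarrow>
     C \<in> Obj V \<and> X \<in> Obj V \<and> \<xi> \<in> Hom V (flat S C X) X \<and>
     \<xi> \<cdot>\<^bsub>V\<^esub> flat_unit V S C X = Idt V X \<and>
     \<xi> \<cdot>\<^bsub>V\<^esub> flat_mult V S C X = \<xi> \<cdot>\<^bsub>V\<^esub> flat_map V S (Idt V C) \<xi>"

definition action_morphism ::
  "('o, 'm) category \<Rightarrow> ('o, 'm) choice \<Rightarrow> 'o \<Rightarrow> 'o \<Rightarrow> 'm \<Rightarrow> 'o \<Rightarrow> 'm \<Rightarrow> 'm \<Rightarrow> bool" where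
  "action_morphism V S C X\<^sub>1 \<xi>\<^sub>1 X\<^sub>2 \<xi>\<^sub>2 f \<longleftrightarrow>
     f \<in> Hom V X\<^sub>1 X\<^sub>2 \<and> f \<cdot>\<^bsub>V\<^esub> \<xi>\<^sub>1 = \<xi>\<^sub>2 \<cdot>\<^bsub>V\<^esub> flat_map V S (Idt V C) f"

definition is_point :: "('o, 'm) category \<Rightarrow> 'o \<Rightarrow> 'm \<Rightarrow> 'm \<Rightarrow> bool" where
  "is_point C B p s \<longleftrightarrow>
     p \<in> Arr C \<and> Cod C p = B \<and> s \<in> Hom C B (Dom C p) \<and> p \<cdot>\<^bsub>C\<^esub> s = Idt C B"

definition point_morphism ::
  "('o, 'm) category \<Rightarrow> 'm \<Rightarrow> 'm \<Rightarrow> 'm \<Rightarrow> 'm \<Rightarrow> 'm \<Rightarrow> bool" where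
  "point_morphism C p\<^sub>1 s\<^sub>1 p\<^sub>2 s\<^sub>2 h \<longleftrightarrow>
     h \<in> Hom C (Dom C p\<^sub>1) (Dom C p\<^sub>2) \<and> p\<^sub>2 \<cdot>\<^bsub>C\<^esub> h = p\<^sub>1 \<and> h \<cdot>\<^bsub>C\<^esub> s\<^sub>1 = s\<^sub>2"

definition associated_via ::
  "('o, 'm) category \<Rightarrow> ('o, 'm) choice \<Rightarrow> 'o \<Rightarrow> 'o \<Rightarrow> 'm \<Rightarrow> 'm \<Rightarrow> 'm \<Rightarrow> 'm \<Rightarrow> bool" where
  "associated_via V S C X \<xi> p s k \<longleftrightarrow>
     is_point V C p s \<and> is_kernel V (zob S) X k p \<and>
     k \<cdot>\<^bsub>V\<^esub> \<xi> = copair V S s k \<cdot>\<^bsub>V\<^esub> kap S C X"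

definition associated ::
  "('o, 'm) category \<Rightarrow> ('o, 'm) choice \<Rightarrow> 'o \<Rightarrow> 'o \<Rightarrow> 'm \<Rightarrow> 'm \<Rightarrow> 'm \<Rightarrow> bool" where
  "associated V S C X \<xi> p s \<longleftrightarrow> (\<exists>k. associated_via V S C X \<xi> p s k)"


section \<open>Relative actions and the BAT property\<close>

text \<open>The data of an adjunction \<open>F \<stileturn> U\<close>, with \<open>U: catU \<rightarrow> catV\<close> and unit \<open>\<eta>\<close>;
  \<open>Uo\<close>, \<open>Fo\<close> are the actions of the functors on objects, \<open>Ua\<close>, \<open>Fa\<close> those on arrows.\<close>

record ('v, 'f, 'u, 'g) adj_data =
  catV :: "('v, 'f) category"
  catU :: "('u, 'g) category"
  Uo :: "'u \<Rightarrow> 'v"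
  Ua :: "'g \<Rightarrow> 'f"
  Fo :: "'v \<Rightarrow> 'u"
  Fa :: "'f \<Rightarrow> 'g"
  eta :: "'v \<Rightarrow> 'f"

definition relative_action ::
  "('v, 'f, 'u, 'g) adj_data \<Rightarrow> ('v, 'f) choice \<Rightarrow> 'u \<Rightarrow> 'v \<Rightarrow> 'f \<Rightarrow> bool" where
  "relative_action E S B X \<xi> \<longleftrightarrow> B \<in> Obj (catU E) \<and> internal_action (catV E) S (Uo E B) X \<xi>"

definition xi0 :: "('v, 'f, 'u, 'g) adj_data \<Rightarrow> ('v, 'f) choice \<Rightarrow> 'v \<Rightarrow> 'f" where
  "xi0 E S X = (let V = catV E; UF0 = Uo E (Fo E (zob S)) in
     THE \<xi>. \<xi> \<in> Hom V (flat S UF0 X) X \<and>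
       eta E X \<cdot>\<^bsub>V\<^esub> \<xi> =
         copair V S (Ua E (Fa E (unique_arr V (zob S) X))) (eta E X) \<cdot>\<^bsub>V\<^esub> kap S UF0 X)"

definition coherent :: "('v, 'f, 'u, 'g) adj_data \<Rightarrow> ('v, 'f) choice \<Rightarrow> 'u \<Rightarrow> 'v \<Rightarrow> 'f \<Rightarrow> bool" where
  "coherent E S B X \<xi> \<longleftrightarrow>
     \<xi> \<cdot>\<^bsub>catV E\<^esub> flat_map (catV E) S (Ua E (unique_arr (catU E) (Fo E (zob S)) B)) (Idt (catV E) X)
       = xi0 E S X"

definition lifts_point ::
  "('v, 'f, 'u, 'g) adj_data \<Rightarrow> 'u \<Rightarrow> 'f \<Rightarrow> 'f \<Rightarrow> 'g \<Rightarrow> 'g \<Rightarrow> 'f \<Rightarrow> bool" where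
  "lifts_point E B p s p' s' \<sigma> \<longleftrightarrow>
     is_point (catU E) B p' s' \<and>
     \<sigma> \<in> Hom (catV E) (Uo E (Dom (catU E) p')) (Dom (catV E) p) \<and> is_iso (catV E) \<sigma> \<and>
     p \<cdot>\<^bsub>catV E\<^esub> \<sigma> = Ua E p' \<and> \<sigma> \<cdot>\<^bsub>catV E\<^esub> Ua E s' = s"

definition ideal_point :: "('v, 'f, 'u, 'g) adj_data \<Rightarrow> 'u \<Rightarrow> 'f \<Rightarrow> 'f \<Rightarrow> bool" where
  "ideal_point E B p s \<longleftrightarrow>
     is_point (catV E) (Uo E B) p s \<and> (\<exists>p' s' \<sigma>. lifts_point E B p s p' s' \<sigma>)"

definition ideal_point_morphism ::
  "('v, 'f, 'u, 'g) adj_data \<Rightarrow> 'u \<Rightarrow> 'f \<Rightarrow> 'f \<Rightarrow> 'f \<Rightarrow> 'f \<Rightarrow> 'f \<Rightarrow> bool" where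
  "ideal_point_morphism E B p\<^sub>1 s\<^sub>1 p\<^sub>2 s\<^sub>2 h \<longleftrightarrow>
     point_morphism (catV E) p\<^sub>1 s\<^sub>1 p\<^sub>2 s\<^sub>2 h \<and>
     (\<exists>p\<^sub>1' s\<^sub>1' \<sigma>\<^sub>1 p\<^sub>2' s\<^sub>2' \<sigma>\<^sub>2 h'.
        lifts_point E B p\<^sub>1 s\<^sub>1 p\<^sub>1' s\<^sub>1' \<sigma>\<^sub>1 \<and> lifts_point E B p\<^sub>2 s\<^sub>2 p\<^sub>2' s\<^sub>2' \<sigma>\<^sub>2 \<and>
        point_morphism (catU E) p\<^sub>1' s\<^sub>1' p\<^sub>2' s\<^sub>2' h' \<and>
        h \<cdot>\<^bsub>catV E\<^esub> \<sigma>\<^sub>1 = \<sigma>\<^sub>2 \<cdot>\<^bsub>catV E\<^esub> Ua E h')"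

definition ideal_action ::
  "('v, 'f, 'u, 'g) adj_data \<Rightarrow> ('v, 'f) choice \<Rightarrow> 'u \<Rightarrow> 'v \<Rightarrow> 'f \<Rightarrow> bool" where
  "ideal_action E S B X \<xi> \<longleftrightarrow>
     (\<forall>p s. associated (catV E) S (Uo E B) X \<xi> p s \<longrightarrow> ideal_point E B p s)"

text \<open>Under the equivalence between points and internal actions, the morphism of points
  corresponding to \<open>f\<close> is the one which restricts to \<open>f\<close> on the kernels.\<close>

definition ideal_action_morphism ::
  "('v, 'f, 'u, 'g) adj_data \<Rightarrow> ('v, 'f) choice \<Rightarrow> 'u \<Rightarrow> 'v \<Rightarrow> 'f \<Rightarrow> 'v \<Rightarrow> 'f \<Rightarrow> 'f \<Rightarrow> bool" where
  "ideal_action_morphism E S B X\<^sub>1 \<xi>\<^sub>1 X\<^sub>2 \<xi>\<^sub>2 f \<longleftrightarrow>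
     (\<forall>p\<^sub>1 s\<^sub>1 k\<^sub>1 p\<^sub>2 s\<^sub>2 k\<^sub>2 h.
        associated_via (catV E) S (Uo E B) X\<^sub>1 \<xi>\<^sub>1 p\<^sub>1 s\<^sub>1 k\<^sub>1 \<longrightarrow>
        associated_via (catV E) S (Uo E B) X\<^sub>2 \<xi>\<^sub>2 p\<^sub>2 s\<^sub>2 k\<^sub>2 \<longrightarrow>
        point_morphism (catV E) p\<^sub>1 s\<^sub>1 p\<^sub>2 s\<^sub>2 h \<longrightarrow>
        h \<cdot>\<^bsub>catV E\<^esub> k\<^sub>1 = k\<^sub>2 \<cdot>\<^bsub>catV E\<^esub> f \<longrightarrow>
        ideal_point_morphism E B p\<^sub>1 s\<^sub>1 p\<^sub>2 s\<^sub>2 h)"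

definition BAT :: "('v, 'f, 'u, 'g) adj_data \<Rightarrow> bool" where
  "BAT E \<longleftrightarrow> (\<forall>S. is_choice (catV E) S \<longrightarrow>
     (\<forall>B X \<xi>. relative_action E S B X \<xi> \<and> coherent E S B X \<xi> \<longrightarrow> ideal_action E S B X \<xi>) \<and>
     (\<forall>B X\<^sub>1 \<xi>\<^sub>1 X\<^sub>2 \<xi>\<^sub>2 f.
        relative_action E S B X\<^sub>1 \<xi>\<^sub>1 \<and> coherent E S B X\<^sub>1 \<xi>\<^sub>1 \<and>
        relative_action E S B X\<^sub>2 \<xi>\<^sub>2 \<and> coherent E S B X\<^sub>2 \<xi>\<^sub>2 \<and>
        action_morphism (catV E) S (Uo E B) X\<^sub>1 \<xi>\<^sub>1 X\<^sub>2 \<xi>\<^sub>2 f \<longrightarrow>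
        ideal_action_morphism E S B X\<^sub>1 \<xi>\<^sub>1 X\<^sub>2 \<xi>\<^sub>2 f))"


section \<open>Non-associative algebras and their varieties\<close>

text \<open>The record type of modules contains a field \<open>one\<close>. It plays no role in the following
  locale; for unital algebras it holds the unit.\<close>

locale nonassoc_algebra = field K + module K A for K (structure) and A (structure) +
  assumes mult_closed: "\<lbrakk>x \<in> carrier A; y \<in> carrier A\<rbrakk> \<Longrightarrow> x \<otimes>\<^bsub>A\<^esub> y \<in> carrier A"
    and mult_add_left: "\<lbrakk>x \<in> carrier A; y \<in> carrier A; z \<in> carrier A\<rbrakk>
      \<Longrightarrow> (x \<oplus>\<^bsub>A\<^esub> y) \<otimes>\<^bsub>A\<^esub> z = (x \<otimes>\<^bsub>A\<^esub> z) \<oplus>\<^bsub>A\<^esub> (y \<otimes>\<^bsub>A\<^esub> z)"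
    and mult_add_right: "\<lbrakk>x \<in> carrier A; y \<in> carrier A; z \<in> carrier A\<rbrakk>
      \<Longrightarrow> z \<otimes>\<^bsub>A\<^esub> (x \<oplus>\<^bsub>A\<^esub> y) = (z \<otimes>\<^bsub>A\<^esub> x) \<oplus>\<^bsub>A\<^esub> (z \<otimes>\<^bsub>A\<^esub> y)"
    and mult_smult_left: "\<lbrakk>a \<in> carrier K; x \<in> carrier A; y \<in> carrier A\<rbrakk>
      \<Longrightarrow> (a \<odot>\<^bsub>A\<^esub> x) \<otimes>\<^bsub>A\<^esub> y = a \<odot>\<^bsub>A\<^esub> (x \<otimes>\<^bsub>A\<^esub> y)"
    and mult_smult_right: "\<lbrakk>a \<in> carrier K; x \<in> carrier A; y \<in> carrier A\<rbrakk>
      \<Longrightarrow> x \<otimes>\<^bsub>A\<^esub> (a \<odot>\<^bsub>A\<^esub> y) = a \<odot>\<^bsub>A\<^esub> (x \<otimes>\<^bsub>A\<^esub> y)"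

definition alg_hom :: "'k ring \<Rightarrow> ('k, 'a) module \<Rightarrow> ('k, 'b) module \<Rightarrow> ('a \<Rightarrow> 'b) \<Rightarrow> bool" where
  "alg_hom K A B h \<longleftrightarrow> h \<in> carrier A \<rightarrow> carrier B \<and>
     (\<forall>x \<in> carrier A. \<forall>y \<in> carrier A. h (x \<oplus>\<^bsub>A\<^esub> y) = h x \<oplus>\<^bsub>B\<^esub> h y) \<and>
     (\<forall>a \<in> carrier K. \<forall>x \<in> carrier A. h (a \<odot>\<^bsub>A\<^esub> x) = a \<odot>\<^bsub>B\<^esub> h x) \<and>
     (\<forall>x \<in> carrier A. \<forall>y \<in> carrier A. h (x \<otimes>\<^bsub>A\<^esub> y) = h x \<otimes>\<^bsub>B\<^esub> h y)"

text \<open>Non-associative polynomials are the elements of the free non-associative algebra on countably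
  many variables: finite linear combinations of non-associative monomials.\<close>

datatype monomial = Var nat | Times monomial monomial

definition nonassoc_polys :: "'k ring \<Rightarrow> (monomial \<Rightarrow> 'k) set" where
  "nonassoc_polys K = {\<phi>. range \<phi> \<subseteq> carrier K \<and> finite {m. \<phi> m \<noteq> \<zero>\<^bsub>K\<^esub>}}"

primrec eval_monomial :: "('k, 'a) module \<Rightarrow> (nat \<Rightarrow> 'a) \<Rightarrow> monomial \<Rightarrow> 'a" where
  "eval_monomial A v (Var i) = v i"
| "eval_monomial A v (Times m n) = eval_monomial A v m \<otimes>\<^bsub>A\<^esub> eval_monomial A v n"

definition eval_poly :: "'k ring \<Rightarrow> ('k, 'a) module \<Rightarrow> (nat \<Rightarrow> 'a) \<Rightarrow> (monomial \<Rightarrow> 'k) \<Rightarrow> 'a" where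
  "eval_poly K A v \<phi> = (\<Oplus>\<^bsub>A\<^esub>m \<in> {m. \<phi> m \<noteq> \<zero>\<^bsub>K\<^esub>}. \<phi> m \<odot>\<^bsub>A\<^esub> eval_monomial A v m)"

definition in_variety :: "'k ring \<Rightarrow> (monomial \<Rightarrow> 'k) set \<Rightarrow> ('k, 'a) module \<Rightarrow> bool" where
  "in_variety K \<Phi> A \<longleftrightarrow> nonassoc_algebra K A \<and>
     (\<forall>\<phi> \<in> \<Phi>. \<forall>v \<in> UNIV \<rightarrow> carrier A. eval_poly K A v \<phi> = \<zero>\<^bsub>A\<^esub>)"

text \<open>The semidirect product of \<open>K\<close> and \<open>X\<close>.\<close>

definition adjoin_unit :: "'k ring \<Rightarrow> ('k, 'a) module \<Rightarrow> ('k, 'k \<times> 'a) module" where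
  "adjoin_unit K X =
    \<lparr>carrier = carrier K \<times> carrier X,
     mult = (\<lambda>(a, x) (b, y). (a \<otimes>\<^bsub>K\<^esub> b, x \<otimes>\<^bsub>X\<^esub> y \<oplus>\<^bsub>X\<^esub> a \<odot>\<^bsub>X\<^esub> y \<oplus>\<^bsub>X\<^esub> b \<odot>\<^bsub>X\<^esub> x)),
     one = (\<one>\<^bsub>K\<^esub>, \<zero>\<^bsub>X\<^esub>),
     zero = (\<zero>\<^bsub>K\<^esub>, \<zero>\<^bsub>X\<^esub>),
     add = (\<lambda>(a, x) (b, y). (a \<oplus>\<^bsub>K\<^esub> b, x \<oplus>\<^bsub>X\<^esub> y)),
     smult = (\<lambda>c (a, x). (c \<otimes>\<^bsub>K\<^esub> a, c \<odot>\<^bsub>X\<^esub> x))\<rparr>"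

definition unit_closed :: "'a itself \<Rightarrow> 'k ring \<Rightarrow> (monomial \<Rightarrow> 'k) set \<Rightarrow> bool" where
  "unit_closed _ K \<Phi> \<longleftrightarrow>
     (\<forall>X :: ('k, 'a) module. in_variety K \<Phi> X \<longrightarrow> in_variety K \<Phi> (adjoin_unit K X))"


section \<open>The adjunction between a variety and its unital algebras\<close>

datatype ('o, 'a) arrow = Arrow (src: 'o) (fn: "'a \<Rightarrow> 'a") (tgt: 'o)

text \<open>Arrows carry functions which are \<open>undefined\<close> outside the carrier of the source, so that
  equality of arrows is equality of maps.\<close>

definition alg_category ::
  "('k, 'a) module set \<Rightarrow> (('k, 'a) module \<Rightarrow> ('k, 'a) module \<Rightarrow> ('a \<Rightarrow> 'a) \<Rightarrow> bool)
    \<Rightarrow> (('k, 'a) module, (('k, 'a) module, 'a) arrow) category" where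
  "alg_category Ob P =
    \<lparr>Obj = Ob,
     Arr = {Arrow A h B | A h B. A \<in> Ob \<and> B \<in> Ob \<and> h \<in> extensional (carrier A) \<and> P A B h},
     Dom = src,
     Cod = tgt,
     Idt = (\<lambda>A. Arrow A (\<lambda>x \<in> carrier A. x) A),
     Cmp = (\<lambda>g f. Arrow (src f) (compose (carrier (src f)) (fn g) (fn f)) (tgt g))\<rparr>"

text \<open>The objects are the algebras of the variety with underlying set contained in \<open>UNIV :: 'a set\<close>.
  As they carry no unit, the field \<open>one\<close> is fixed to be \<open>undefined\<close>.\<close>

definition variety ::
  "'k ring \<Rightarrow> (monomial \<Rightarrow> 'k) set \<Rightarrow> (('k, 'a) module, (('k, 'a) module, 'a) arrow) category" where
  "variety K \<Phi> = alg_category {A. in_variety K \<Phi> A \<and> one A = undefined} (alg_hom K)"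

definition unital_variety ::
  "'k ring \<Rightarrow> (monomial \<Rightarrow> 'k) set \<Rightarrow> (('k, 'a) module, (('k, 'a) module, 'a) arrow) category" where
  "unital_variety K \<Phi> = alg_category
     {A. in_variety K \<Phi> A \<and> \<one>\<^bsub>A\<^esub> \<in> carrier A \<and>
         (\<forall>x \<in> carrier A. \<one>\<^bsub>A\<^esub> \<otimes>\<^bsub>A\<^esub> x = x \<and> x \<otimes>\<^bsub>A\<^esub> \<one>\<^bsub>A\<^esub> = x)}
     (\<lambda>A B h. alg_hom K A B h \<and> h \<one>\<^bsub>A\<^esub> = \<one>\<^bsub>B\<^esub>)"

definition forget_unit :: "('k, 'a) module \<Rightarrow> ('k, 'a) module" where
  "forget_unit A = A\<lparr>one := undefined\<rparr>"

text \<open>The algebra structure on the image of the carrier of \<open>A\<close> under \<open>e\<close>, for \<open>e\<close> injective on the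
  carrier, which makes \<open>e\<close> an isomorphism.\<close>

definition transport :: "('b \<Rightarrow> 'a) \<Rightarrow> ('k, 'b) module \<Rightarrow> ('k, 'a) module" where
  "transport e A = (let d = inv_into (carrier A) e in
    \<lparr>carrier = e ` carrier A,
     mult = (\<lambda>x y. e (d x \<otimes>\<^bsub>A\<^esub> d y)),
     one = e \<one>\<^bsub>A\<^esub>,
     zero = e \<zero>\<^bsub>A\<^esub>,
     add = (\<lambda>x y. e (d x \<oplus>\<^bsub>A\<^esub> d y)),
     smult = (\<lambda>c x. e (c \<odot>\<^bsub>A\<^esub> d x))\<rparr>)"

text \<open>The elements of the semidirect product of \<open>K\<close> and \<open>X\<close> are pairs; they are encoded in the type
  \<open>'a\<close> by a function \<open>e\<close>, injective on \<open>carrier K \<times> UNIV\<close>. Such a function exists if and only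
  if \<open>'a\<close> is infinite and the cardinality of \<open>K\<close> is at most that of \<open>'a\<close>; in this case the algebras
  with underlying set in \<open>'a\<close> are closed under binary coproducts in the variety as well.\<close>

definition free_unital :: "'k ring \<Rightarrow> ('k \<times> 'a \<Rightarrow> 'a) \<Rightarrow> ('k, 'a) module \<Rightarrow> ('k, 'a) module" where
  "free_unital K e X = transport e (adjoin_unit K X)"

definition unital_context ::
  "'k ring \<Rightarrow> (monomial \<Rightarrow> 'k) set \<Rightarrow> ('k \<times> 'a \<Rightarrow> 'a) \<Rightarrow>
   (('k, 'a) module, (('k, 'a) module, 'a) arrow, ('k, 'a) module, (('k, 'a) module, 'a) arrow) adj_data"
where
  "unital_context K \<Phi> e =
    \<lparr>catV = variety K \<Phi>,
     catU = unital_variety K \<Phi>,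
     Uo = forget_unit,
     Ua = (\<lambda>f. Arrow (forget_unit (src f)) (fn f) (forget_unit (tgt f))),
     Fo = free_unital K e,
     Fa = (\<lambda>f. Arrow (free_unital K e (src f))
       (\<lambda>z \<in> carrier (free_unital K e (src f)).
          e (map_prod id (fn f) (inv_into (carrier K \<times> carrier (src f)) e z)))
       (free_unital K e (tgt f))),
     eta = (\<lambda>X. Arrow X (\<lambda>x \<in> carrier X. e (\<zero>\<^bsub>K\<^esub>, x)) (forget_unit (free_unital K e X)))\<rparr>"

end

theory Submission
  imports Defs
begin

text \<open>Let \<open>(p: A \<rightarrow> U(B), s)\<close> be a point with kernel \<open>k: X \<rightarrow> A\<close>, associated with a coherent action.
  The only candidate for a unit of \<open>A\<close> that \<open>s\<close> preserves is \<open>s(1)\<close>. Every element of \<open>A\<close> is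
  a sum of an element of \<open>s(B)\<close>, on which \<open>s(1)\<close> acts as \<open>1\<close> acts on \<open>B\<close>, and of one of the kernel
  \<open>k(X)\<close>. So all that is needed is that \<open>s(1)\<close> fixes \<open>k(X)\<close> under multiplication on both sides, and
  this is what coherence provides (\<open>coherent_one_acts_trivially\<close>).

  Indeed, restricting the action along \<open>UF(0) \<rightarrow> U(B)\<close> only sees the elements of \<open>B\<close> which are
  multiples of \<open>1\<close>, while \<open>\<xi>\<^sub>0\<close> describes how these multiples act on \<open>X\<close> inside \<open>UF(X)\<close>, where \<open>1\<close> is
  the unit by construction. The two actions are compared on the elements \<open>i\<^sub>1(1) i\<^sub>2(x)\<close> and
  \<open>i\<^sub>2(x) i\<^sub>1(1)\<close> of \<open>UF(0) + X\<close>. They belong to \<open>UF(0)\<flat>X\<close> because a categorical kernel in a variety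
  has all elements sent to zero in its image (\<open>kernel_surj\<close>), which rests on closure under
  subalgebras.

  Once \<open>A\<close> is unital with unit \<open>s(1)\<close>, the maps \<open>p\<close> and \<open>s\<close> preserve units and the point lifts to
  \<open>V\<^sub>1\<close> with \<open>\<sigma> = id\<close>. A morphism of such points commutes with the sections, so it preserves
  units and lifts as well.\<close>

section \<open>Zero arrows, kernels and coproducts in a category with chosen structure\<close>

locale category_laws =
  fixes V :: "('o, 'm) category" (structure)
  assumes Arr_Hom: "f \<in> Arr V \<Longrightarrow> Dom V f \<in> Obj V \<and> Cod V f \<in> Obj V"
    and Idt_Hom: "A \<in> Obj V \<Longrightarrow> Idt V A \<in> Hom V A A"
    and Cmp_Hom: "\<lbrakk>f \<in> Hom V A B; g \<in> Hom V B D\<rbrakk> \<Longrightarrow> g \<cdot> f \<in> Hom V A D"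
    and Cmp_assoc: "\<lbrakk>f \<in> Hom V A B; g \<in> Hom V B D; h \<in> Hom V D E\<rbrakk> \<Longrightarrow> h \<cdot> (g \<cdot> f) = (h \<cdot> g) \<cdot> f"
    and Cmp_Idt: "f \<in> Hom V A B \<Longrightarrow> f \<cdot> Idt V A = f"
    and Idt_Cmp: "f \<in> Hom V A B \<Longrightarrow> Idt V B \<cdot> f = f"
begin

lemma HomD: "f \<in> Hom V A B \<Longrightarrow> A \<in> Obj V \<and> B \<in> Obj V \<and> Dom V f = A \<and> Cod V f = B \<and> f \<in> Arr V"
  using Arr_Hom by (auto simp: Hom_def)

end

locale category_with_choice = category_laws +
  fixes S :: "('o, 'm) choice"
  assumes choice: "is_choice V S"
begin

abbreviation zero_arr' (\<open>\<zero>\<^sub>a\<close>) where "\<zero>\<^sub>a \<equiv> zero_arr V (zob S)"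

lemma zob_Obj: "zob S \<in> Obj V"
  using choice by (simp add: is_choice_def zero_object_def)

lemma ex1_from_zob: "A \<in> Obj V \<Longrightarrow> \<exists>!f. f \<in> Hom V (zob S) A"
  and ex1_to_zob: "A \<in> Obj V \<Longrightarrow> \<exists>!f. f \<in> Hom V A (zob S)"
  using choice by (simp_all add: is_choice_def zero_object_def)

lemma unique_arr_from_zob: "A \<in> Obj V \<Longrightarrow> unique_arr V (zob S) A \<in> Hom V (zob S) A"
  and unique_arr_to_zob: "A \<in> Obj V \<Longrightarrow> unique_arr V A (zob S) \<in> Hom V A (zob S)"
  unfolding unique_arr_def by (rule theI', erule ex1_from_zob ex1_to_zob)+

lemma zero_arr_Hom: "\<lbrakk>A \<in> Obj V; B \<in> Obj V\<rbrakk> \<Longrightarrow> \<zero>\<^sub>a A B \<in> Hom V A B"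
  unfolding zero_arr_def using Cmp_Hom unique_arr_from_zob unique_arr_to_zob by blast

lemma zero_arr_Cmp:
  assumes f: "f \<in> Hom V A B" and D: "D \<in> Obj V"
  shows "\<zero>\<^sub>a B D \<cdot> f = \<zero>\<^sub>a A D"
proof -
  have AB: "A \<in> Obj V" "B \<in> Obj V" using HomD f by auto
  have "unique_arr V B (zob S) \<cdot> f = unique_arr V A (zob S)"
    using ex1_to_zob[OF AB(1)] Cmp_Hom[OF f unique_arr_to_zob[OF AB(2)]] unique_arr_to_zob[OF AB(1)]
    by blast
  then show ?thesis
    unfolding zero_arr_def
    using Cmp_assoc[OF f unique_arr_to_zob[OF AB(2)] unique_arr_from_zob[OF D]] by simp
qed

lemma Cmp_zero_arr:
  assumes f: "f \<in> Hom V B D" and A: "A \<in> Obj V"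
  shows "f \<cdot> \<zero>\<^sub>a A B = \<zero>\<^sub>a A D"
proof -
  have BD: "B \<in> Obj V" "D \<in> Obj V" using HomD f by auto
  have "f \<cdot> unique_arr V (zob S) B = unique_arr V (zob S) D"
    using ex1_from_zob[OF BD(2)] Cmp_Hom[OF unique_arr_from_zob[OF BD(1)] f]
      unique_arr_from_zob[OF BD(2)] by blast
  then show ?thesis
    unfolding zero_arr_def
    using Cmp_assoc[OF unique_arr_to_zob[OF A] unique_arr_from_zob[OF BD(1)] f] by simp
qed

lemma in_Hom:
  assumes "C \<in> Obj V" "X \<in> Obj V"
  shows "in1 S C X \<in> Hom V C (cop S C X)" "in2 S C X \<in> Hom V X (cop S C X)"
  using choice assms by (simp_all add: is_choice_def is_coproduct_def)

lemma copair:
  assumes f: "f \<in> Hom V C W" and g: "g \<in> Hom V X W"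
  shows copair_Hom: "copair V S f g \<in> Hom V (cop S C X) W"
    and copair_in1: "copair V S f g \<cdot> in1 S C X = f"
    and copair_in2: "copair V S f g \<cdot> in2 S C X = g"
    and copair_eqI: "\<lbrakk>h \<in> Hom V (cop S C X) W; h \<cdot> in1 S C X = f; h \<cdot> in2 S C X = g\<rbrakk>
      \<Longrightarrow> copair V S f g = h"
proof -
  have D: "Dom V f = C" "Dom V g = X" "Cod V f = W" "C \<in> Obj V" "X \<in> Obj V" "W \<in> Obj V"
    using HomD f g by auto
  have ex1: "\<exists>!h. h \<in> Hom V (cop S C X) W \<and> h \<cdot> in1 S C X = f \<and> h \<cdot> in2 S C X = g"
    using choice f g D unfolding is_choice_def is_coproduct_def by blast
  have eq: "copair V S f g =
      (THE h. h \<in> Hom V (cop S C X) W \<and> h \<cdot> in1 S C X = f \<and> h \<cdot> in2 S C X = g)"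
    by (simp add: copair_def D)
  show "copair V S f g \<in> Hom V (cop S C X) W" "copair V S f g \<cdot> in1 S C X = f"
      "copair V S f g \<cdot> in2 S C X = g"
    unfolding eq using theI'[OF ex1] by auto
  show "\<lbrakk>h \<in> Hom V (cop S C X) W; h \<cdot> in1 S C X = f; h \<cdot> in2 S C X = g\<rbrakk>
      \<Longrightarrow> copair V S f g = h"
    unfolding eq using the1_equality[OF ex1] by blast
qed

lemma Cmp_copair:
  assumes f: "f \<in> Hom V C W" and g: "g \<in> Hom V X W" and h: "h \<in> Hom V W W'"
  shows "h \<cdot> copair V S f g = copair V S (h \<cdot> f) (h \<cdot> g)"
proof -
  have CX: "C \<in> Obj V" "X \<in> Obj V" using HomD f g by auto
  show ?thesis
  proof (rule copair_eqI[symmetric, OF Cmp_Hom[OF f h] Cmp_Hom[OF g h]])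
    show "h \<cdot> copair V S f g \<in> Hom V (cop S C X) W'"
      using Cmp_Hom[OF copair_Hom[OF f g] h] .
    show "(h \<cdot> copair V S f g) \<cdot> in1 S C X = h \<cdot> f" "(h \<cdot> copair V S f g) \<cdot> in2 S C X = h \<cdot> g"
      using Cmp_assoc[OF in_Hom(1)[OF CX] copair_Hom[OF f g] h]
        Cmp_assoc[OF in_Hom(2)[OF CX] copair_Hom[OF f g] h]
      by (simp_all add: copair_in1[OF f g] copair_in2[OF f g])
  qed
qed

lemma cop_map_Hom:
  assumes "g \<in> Hom V C D" "f \<in> Hom V X Y"
  shows "cop_map V S g f \<in> Hom V (cop S C X) (cop S D Y)"
proof -
  have O: "D \<in> Obj V" "Y \<in> Obj V" "Cod V g = D" "Cod V f = Y" using HomD assms by auto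
  show ?thesis
    unfolding cop_map_def O(3,4)
    by (rule copair_Hom) (use O in_Hom Cmp_Hom assms in blast)+
qed

lemma copair_cop_map:
  assumes g: "g \<in> Hom V C D" and f: "f \<in> Hom V X Y" and a: "a \<in> Hom V D W" and b: "b \<in> Hom V Y W"
  shows "copair V S a b \<cdot> cop_map V S g f = copair V S (a \<cdot> g) (b \<cdot> f)"
proof -
  have O: "D \<in> Obj V" "Y \<in> Obj V" "Cod V g = D" "Cod V f = Y" using HomD g f by auto
  note i = in_Hom[OF O(1,2)]
  show ?thesis
    unfolding cop_map_def O(3,4)
    by (simp add: Cmp_copair[OF Cmp_Hom[OF g i(1)] Cmp_Hom[OF f i(2)] copair_Hom[OF a b]]
        Cmp_assoc[OF g i(1) copair_Hom[OF a b]] Cmp_assoc[OF f i(2) copair_Hom[OF a b]]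
        copair_in1[OF a b] copair_in2[OF a b])
qed

abbreviation retraction where
  "retraction C X \<equiv> copair V S (Idt V C) (\<zero>\<^sub>a X C)"

lemma retraction_Hom: "\<lbrakk>C \<in> Obj V; X \<in> Obj V\<rbrakk> \<Longrightarrow> retraction C X \<in> Hom V (cop S C X) C"
  by (intro copair_Hom Idt_Hom zero_arr_Hom)

lemma kap_kernel:
  assumes "C \<in> Obj V" "X \<in> Obj V"
  shows "is_kernel V (zob S) (flat S C X) (kap S C X) (retraction C X)"
  using choice assms by (simp add: is_choice_def)

lemma kernelD:
  assumes "is_kernel V (zob S) N k p" "p \<in> Hom V A B"
  shows "N \<in> Obj V" "k \<in> Hom V N A" "p \<cdot> k = \<zero>\<^sub>a N B"
    and "\<lbrakk>f \<in> Hom V W A; p \<cdot> f = \<zero>\<^sub>a W B\<rbrakk> \<Longrightarrow> \<exists>!g. g \<in> Hom V W N \<and> k \<cdot> g = f"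
  using assms HomD[OF assms(2)] HomD[of f W A] by (auto simp: is_kernel_def)

lemma kap_Hom: "\<lbrakk>C \<in> Obj V; X \<in> Obj V\<rbrakk> \<Longrightarrow> kap S C X \<in> Hom V (flat S C X) (cop S C X)"
  using kernelD(2)[OF kap_kernel retraction_Hom] by blast

lemma retraction_kap: "\<lbrakk>C \<in> Obj V; X \<in> Obj V\<rbrakk> \<Longrightarrow> retraction C X \<cdot> kap S C X = \<zero>\<^sub>a (flat S C X) C"
  using kernelD(3)[OF kap_kernel retraction_Hom] by blast

lemma flat_Obj: "\<lbrakk>C \<in> Obj V; X \<in> Obj V\<rbrakk> \<Longrightarrow> flat S C X \<in> Obj V"
  using kernelD(1)[OF kap_kernel retraction_Hom] by blast

text \<open>The pair \<open>(g, f)\<close> induces a map of the points \<open>C + X \<rightarrow> C\<close> and \<open>D + Y \<rightarrow> D\<close>, hence one of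
  their kernels; this makes the description of \<open>g\<flat>f\<close> meaningful.\<close>

lemma flat_map:
  assumes g: "g \<in> Hom V C D" and f: "f \<in> Hom V X Y"
  shows flat_map_Hom: "flat_map V S g f \<in> Hom V (flat S C X) (flat S D Y)"
    and kap_flat_map: "kap S D Y \<cdot> flat_map V S g f = cop_map V S g f \<cdot> kap S C X"
proof -
  have O: "C \<in> Obj V" "X \<in> Obj V" "D \<in> Obj V" "Y \<in> Obj V" "Dom V g = C" "Dom V f = X"
      "Cod V g = D" "Cod V f = Y"
    using HomD g f by auto
  note Id = Idt_Hom[OF O(1)] Idt_Hom[OF O(3)]
  note z = zero_arr_Hom[OF O(2,1)] zero_arr_Hom[OF O(4,3)]
  note K = kap_Hom[OF O(1,2)]
  note c = cop_map_Hom[OF g f]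
  have "retraction D Y \<cdot> cop_map V S g f = g \<cdot> retraction C X"
    by (simp add: copair_cop_map[OF g f Id(2) z(2)] Cmp_copair[OF Id(1) z(1) g]
        Idt_Cmp[OF g] Cmp_Idt[OF g] zero_arr_Cmp[OF f O(3)] Cmp_zero_arr[OF g O(2)])
  then have "retraction D Y \<cdot> (cop_map V S g f \<cdot> kap S C X) = g \<cdot> (retraction C X \<cdot> kap S C X)"
    by (simp add: Cmp_assoc[OF K c retraction_Hom[OF O(3,4)]]
        Cmp_assoc[OF K retraction_Hom[OF O(1,2)] g])
  also have "\<dots> = \<zero>\<^sub>a (flat S C X) D"
    by (simp add: retraction_kap[OF O(1,2)] Cmp_zero_arr[OF g flat_Obj[OF O(1,2)]])
  finally have ex1: "\<exists>!m. m \<in> Hom V (flat S C X) (flat S D Y) \<and>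
      kap S D Y \<cdot> m = cop_map V S g f \<cdot> kap S C X"
    by (intro kernelD(4)[OF kap_kernel[OF O(3,4)] retraction_Hom[OF O(3,4)]] Cmp_Hom[OF K c])
  have eq: "flat_map V S g f = (THE m. m \<in> Hom V (flat S C X) (flat S D Y) \<and>
      kap S D Y \<cdot> m = cop_map V S g f \<cdot> kap S C X)"
    by (simp add: flat_map_def O)
  show "flat_map V S g f \<in> Hom V (flat S C X) (flat S D Y)"
      "kap S D Y \<cdot> flat_map V S g f = cop_map V S g f \<cdot> kap S C X"
    unfolding eq using theI'[OF ex1] by auto
qed

text \<open>Since \<open>p\<close> sends \<open>[s, k]\<close> to \<open>[id, 0]\<close>, the map \<open>[s, k] \<kappa>\<close> factors through the kernel \<open>k\<close> of
  \<open>p\<close>. This lift is the action associated with the point;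
  existence and uniqueness give a meaning to the description of \<open>\<xi>\<^sub>0\<close> as the arrow with this property.\<close>

lemma ex1_action_of_point:
  assumes p: "p \<in> Hom V A C" and s: "s \<in> Hom V C A" and ps: "p \<cdot> s = Idt V C"
    and k: "is_kernel V (zob S) X k p"
  shows "\<exists>!\<xi>. \<xi> \<in> Hom V (flat S C X) X \<and> k \<cdot> \<xi> = copair V S s k \<cdot> kap S C X"
proof -
  have O: "C \<in> Obj V" "X \<in> Obj V" using HomD s kernelD(1)[OF k p] by auto
  note kH = kernelD(2)[OF k p]
  note K = kap_Hom[OF O]
  note sk = copair_Hom[OF s kH]
  have "p \<cdot> (copair V S s k \<cdot> kap S C X) = retraction C X \<cdot> kap S C X"
    by (simp add: Cmp_assoc[OF K sk p] Cmp_copair[OF s kH p] ps kernelD(3)[OF k p])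
  then show ?thesis
    by (intro kernelD(4)[OF k p] Cmp_Hom[OF K sk]) (simp add: retraction_kap[OF O])
qed

text \<open>Since \<open>\<kappa> (g\<flat>id) = (g + id) \<kappa>\<close>, and \<open>[s, k] (g + id) = [s g, k]\<close>, restricting an action along
  \<open>g\<close> amounts to precomposing the section with \<open>g\<close>. With \<open>g\<close> the arrow \<open>UF(0) \<rightarrow> U(B)\<close>, this turns
  coherence into an equation between arrows into the domain of the point.\<close>

lemma restricted_action:
  assumes g: "g \<in> Hom V C D" and s: "s \<in> Hom V D A" and k: "k \<in> Hom V X A"
    and \<xi>: "\<xi> \<in> Hom V (flat S D X) X" and eq: "k \<cdot> \<xi> = copair V S s k \<cdot> kap S D X"
  shows "k \<cdot> (\<xi> \<cdot> flat_map V S g (Idt V X)) = copair V S (s \<cdot> g) k \<cdot> kap S C X"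
proof -
  have O: "C \<in> Obj V" "X \<in> Obj V" "D \<in> Obj V" using HomD g k by auto
  note Id = Idt_Hom[OF O(2)]
  note m = flat_map[OF g Id]
  note sk = copair_Hom[OF s k]
  have "k \<cdot> (\<xi> \<cdot> flat_map V S g (Idt V X)) = copair V S s k \<cdot> (kap S D X \<cdot> flat_map V S g (Idt V X))"
    by (simp add: Cmp_assoc[OF m(1) \<xi> k] eq Cmp_assoc[OF m(1) kap_Hom[OF O(3,2)] sk])
  also have "\<dots> = (copair V S s k \<cdot> cop_map V S g (Idt V X)) \<cdot> kap S C X"
    by (simp add: m(2) Cmp_assoc[OF kap_Hom[OF O(1,2)] cop_map_Hom[OF g Id] sk])
  finally show ?thesis
    by (simp add: copair_cop_map[OF g Id s k] Cmp_Idt[OF k])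
qed

end


section \<open>Homomorphisms and identities of non-associative algebras\<close>

lemma alg_homD:
  assumes "alg_hom K A B h"
  shows "x \<in> carrier A \<Longrightarrow> h x \<in> carrier B"
    and "\<lbrakk>x \<in> carrier A; y \<in> carrier A\<rbrakk> \<Longrightarrow> h (x \<oplus>\<^bsub>A\<^esub> y) = h x \<oplus>\<^bsub>B\<^esub> h y"
    and "\<lbrakk>a \<in> carrier K; x \<in> carrier A\<rbrakk> \<Longrightarrow> h (a \<odot>\<^bsub>A\<^esub> x) = a \<odot>\<^bsub>B\<^esub> h x"
    and "\<lbrakk>x \<in> carrier A; y \<in> carrier A\<rbrakk> \<Longrightarrow> h (x \<otimes>\<^bsub>A\<^esub> y) = h x \<otimes>\<^bsub>B\<^esub> h y"
  using assms by (auto simp: alg_hom_def)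

lemma alg_hom_zero:
  assumes "nonassoc_algebra K A" "nonassoc_algebra K B" "alg_hom K A B h"
  shows "h \<zero>\<^bsub>A\<^esub> = \<zero>\<^bsub>B\<^esub>"
proof -
  interpret A: nonassoc_algebra K A by fact
  interpret B: nonassoc_algebra K B by fact
  have "h \<zero>\<^bsub>A\<^esub> \<oplus>\<^bsub>B\<^esub> h \<zero>\<^bsub>A\<^esub> = h \<zero>\<^bsub>A\<^esub>"
    using alg_homD(2)[OF assms(3) A.zero_closed A.zero_closed] by simp
  then show ?thesis
    using alg_homD(1)[OF assms(3) A.zero_closed] B.add.l_cancel_one by simp
qed

lemma eval_monomial_closed:
  assumes "nonassoc_algebra K A" "v \<in> UNIV \<rightarrow> carrier A"
  shows "eval_monomial A v m \<in> carrier A"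
  using assms by (induction m) (auto intro: nonassoc_algebra.mult_closed)

lemma alg_hom_eval_monomial:
  assumes "nonassoc_algebra K A" "alg_hom K A B h" "v \<in> UNIV \<rightarrow> carrier A"
  shows "h (eval_monomial A v m) = eval_monomial B (h \<circ> v) m"
  using assms by (induction m) (auto simp: alg_homD(4) eval_monomial_closed)

lemma alg_hom_eval_poly:
  assumes A: "nonassoc_algebra K A" and B: "nonassoc_algebra K B" and h: "alg_hom K A B h"
    and v: "v \<in> UNIV \<rightarrow> carrier A" and \<phi>: "\<phi> \<in> nonassoc_polys K"
  shows "h (eval_poly K A v \<phi>) = eval_poly K B (h \<circ> v) \<phi>"
proof -
  interpret A: nonassoc_algebra K A by fact
  interpret B: nonassoc_algebra K B by fact
  have K: "\<phi> m \<in> carrier K" for m using \<phi> by (auto simp: nonassoc_polys_def)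
  have cA: "\<phi> m \<odot>\<^bsub>A\<^esub> eval_monomial A v m \<in> carrier A" for m
    using K eval_monomial_closed[OF A v] by simp
  have ht: "h (\<phi> m \<odot>\<^bsub>A\<^esub> eval_monomial A v m) = \<phi> m \<odot>\<^bsub>B\<^esub> eval_monomial B (h \<circ> v) m" for m
    using K eval_monomial_closed[OF A v] alg_homD(3)[OF h] alg_hom_eval_monomial[OF A h v] by simp
  have cB: "\<phi> m \<odot>\<^bsub>B\<^esub> eval_monomial B (h \<circ> v) m \<in> carrier B" for m
    using alg_homD(1)[OF h cA] ht by metis
  have "h (\<Oplus>\<^bsub>A\<^esub>m\<in>M. \<phi> m \<odot>\<^bsub>A\<^esub> eval_monomial A v m) = (\<Oplus>\<^bsub>B\<^esub>m\<in>M. \<phi> m \<odot>\<^bsub>B\<^esub> eval_monomial B (h \<circ> v) m)"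
    if "finite M" for M
    using that
  proof induction
    case empty
    then show ?case by (simp add: alg_hom_zero[OF A B h])
  next
    case (insert m M)
    have "(\<Oplus>\<^bsub>A\<^esub>m\<in>M. \<phi> m \<odot>\<^bsub>A\<^esub> eval_monomial A v m) \<in> carrier A"
      using cA by (intro A.finsum_closed) auto
    with insert show ?case
      using cA cB by (simp add: A.finsum_insert B.finsum_insert alg_homD(2)[OF h] ht Pi_def o_def)
  qed
  with \<phi> show ?thesis by (simp add: eval_poly_def nonassoc_polys_def)
qed

text \<open>Every equational axiom can be checked after applying an injective map; negatives, the only
  existential axiom, are multiples by \<open>-1\<close>. So a set with operations that embeds in an algebra of
  a variety belongs to the variety. This covers subalgebras, transported structures and a change
  of the field \<open>one\<close>.\<close>

lemma in_variety_if_embeds: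
  assumes B: "in_variety K \<Phi> B" and \<Phi>: "\<Phi> \<subseteq> nonassoc_polys K"
    and h: "alg_hom K A B h" and inj: "inj_on h (carrier A)"
    and zero: "\<zero>\<^bsub>A\<^esub> \<in> carrier A" "h \<zero>\<^bsub>A\<^esub> = \<zero>\<^bsub>B\<^esub>"
    and add: "\<And>x y. \<lbrakk>x \<in> carrier A; y \<in> carrier A\<rbrakk> \<Longrightarrow> x \<oplus>\<^bsub>A\<^esub> y \<in> carrier A"
    and smult: "\<And>a x. \<lbrakk>a \<in> carrier K; x \<in> carrier A\<rbrakk> \<Longrightarrow> a \<odot>\<^bsub>A\<^esub> x \<in> carrier A"
    and mult: "\<And>x y. \<lbrakk>x \<in> carrier A; y \<in> carrier A\<rbrakk> \<Longrightarrow> x \<otimes>\<^bsub>A\<^esub> y \<in> carrier A"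
  shows "in_variety K \<Phi> A"
proof -
  have B': "nonassoc_algebra K B" using B by (simp add: in_variety_def)
  interpret B: nonassoc_algebra K B by fact
  note D = alg_homD[OF h]
  note [simp] = D zero add smult mult
  have eqI: "x = y" if "h x = h y" "x \<in> carrier A" "y \<in> carrier A" for x y
    using inj that by (auto dest: inj_onD)
  have "abelian_group A"
  proof (rule abelian_groupI)
    fix x assume x: "x \<in> carrier A"
    have "\<ominus>\<^bsub>K\<^esub> \<one>\<^bsub>K\<^esub> \<odot>\<^bsub>A\<^esub> x \<oplus>\<^bsub>A\<^esub> x = \<zero>\<^bsub>A\<^esub>"
      by (rule eqI) (use x in \<open>simp_all add: B.smult_l_minus B.M.l_neg\<close>)
    then show "\<exists>y\<in>carrier A. y \<oplus>\<^bsub>A\<^esub> x = \<zero>\<^bsub>A\<^esub>" using x by force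
  qed (auto intro!: eqI simp: B.M.a_ac)
  then have "module K A"
    by (intro moduleI B.module_axioms[THEN module.axioms(1)])
      (auto intro!: eqI simp: B.smult_l_distr B.smult_r_distr B.smult_assoc1)
  then have A: "nonassoc_algebra K A"
    by (intro nonassoc_algebra.intro nonassoc_algebra_axioms.intro B.field_axioms)
      (auto intro!: eqI simp: B.mult_add_left B.mult_add_right B.mult_smult_left
        B.mult_smult_right B.mult_closed)
  interpret A: nonassoc_algebra K A by fact
  have "eval_poly K A v \<phi> = \<zero>\<^bsub>A\<^esub>" if \<phi>: "\<phi> \<in> \<Phi>" and v: "v \<in> UNIV \<rightarrow> carrier A" for \<phi> v
  proof (rule eqI)
    have "h \<circ> v \<in> UNIV \<rightarrow> carrier B" using v by (auto simp: Pi_iff)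
    then show "h (eval_poly K A v \<phi>) = h \<zero>\<^bsub>A\<^esub>"
      using alg_hom_eval_poly[OF A B' h v] \<phi> \<Phi> B by (auto simp: in_variety_def)
    have "\<phi> m \<in> carrier K" for m using \<phi> \<Phi> by (auto simp: nonassoc_polys_def)
    then show "eval_poly K A v \<phi> \<in> carrier A"
      unfolding eval_poly_def
      using eval_monomial_closed[OF A v] by (intro A.finsum_closed) auto
  qed simp
  with A show ?thesis by (simp add: in_variety_def)
qed

lemma in_variety_one_update:
  assumes "in_variety K \<Phi> A" "\<Phi> \<subseteq> nonassoc_polys K"
  shows "in_variety K \<Phi> (A\<lparr>one := u\<rparr>)"
proof -
  interpret A: nonassoc_algebra K A using assms by (simp add: in_variety_def)
  show ?thesis
    by (rule in_variety_if_embeds[OF assms, where h = id]) (auto simp: alg_hom_def A.mult_closed)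
qed


section \<open>Adjoining a unit\<close>

lemma transport_ops:
  assumes inj: "inj_on e (carrier A)"
  shows "\<lbrakk>x \<in> carrier A; y \<in> carrier A\<rbrakk> \<Longrightarrow> e x \<otimes>\<^bsub>transport e A\<^esub> e y = e (x \<otimes>\<^bsub>A\<^esub> y)"
    and "\<lbrakk>x \<in> carrier A; y \<in> carrier A\<rbrakk> \<Longrightarrow> e x \<oplus>\<^bsub>transport e A\<^esub> e y = e (x \<oplus>\<^bsub>A\<^esub> y)"
    and "x \<in> carrier A \<Longrightarrow> a \<odot>\<^bsub>transport e A\<^esub> e x = e (a \<odot>\<^bsub>A\<^esub> x)"
  using assms by (simp_all add: transport_def Let_def inv_into_f_f)

lemma transport_consts:
  "carrier (transport e A) = e ` carrier A" "\<zero>\<^bsub>transport e A\<^esub> = e \<zero>\<^bsub>A\<^esub>" "\<one>\<^bsub>transport e A\<^esub> = e \<one>\<^bsub>A\<^esub>"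
  by (simp_all add: transport_def Let_def)

lemma in_variety_transport:
  assumes A: "in_variety K \<Phi> A" and \<Phi>: "\<Phi> \<subseteq> nonassoc_polys K" and inj: "inj_on e (carrier A)"
  shows "in_variety K \<Phi> (transport e A)"
proof -
  interpret A: nonassoc_algebra K A using A by (simp add: in_variety_def)
  show ?thesis
    by (rule in_variety_if_embeds[OF A \<Phi>, where h = "inv_into (carrier A) e"])
      (auto simp: alg_hom_def transport_consts transport_ops[OF inj] inv_into_f_f[OF inj]
        A.mult_closed inj_on_inv_into)
qed

locale unit_closed_variety =
  fixes K :: "'k ring"
    and \<Phi> :: "(monomial \<Rightarrow> 'k) set"
    and e :: "'k \<times> 'a \<Rightarrow> 'a"
  assumes field: "field K"
    and polys: "\<Phi> \<subseteq> nonassoc_polys K"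
    and inj_e: "inj_on e (carrier K \<times> UNIV)"
    and unit_closed: "unit_closed TYPE('a) K \<Phi>"
begin

sublocale K: field K by (rule field)

abbreviation F where "F \<equiv> free_unital K e"

lemma F_inj: "inj_on e (carrier K \<times> carrier X)"
  using inj_e by (rule inj_on_subset) auto

lemma F_carrier: "carrier (F X) = e ` (carrier K \<times> carrier X)"
  and F_zero: "\<zero>\<^bsub>F X\<^esub> = e (\<zero>\<^bsub>K\<^esub>, \<zero>\<^bsub>X\<^esub>)"
  and F_one: "\<one>\<^bsub>F X\<^esub> = e (\<one>\<^bsub>K\<^esub>, \<zero>\<^bsub>X\<^esub>)"
  by (simp_all add: free_unital_def transport_consts adjoin_unit_def)

lemma F_mult:
    "\<lbrakk>a \<in> carrier K; b \<in> carrier K; x \<in> carrier X; y \<in> carrier X\<rbrakk> \<Longrightarrow>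
      e (a, x) \<otimes>\<^bsub>F X\<^esub> e (b, y) = e (a \<otimes>\<^bsub>K\<^esub> b, x \<otimes>\<^bsub>X\<^esub> y \<oplus>\<^bsub>X\<^esub> a \<odot>\<^bsub>X\<^esub> y \<oplus>\<^bsub>X\<^esub> b \<odot>\<^bsub>X\<^esub> x)"
  and F_add:
    "\<lbrakk>a \<in> carrier K; b \<in> carrier K; x \<in> carrier X; y \<in> carrier X\<rbrakk> \<Longrightarrow>
      e (a, x) \<oplus>\<^bsub>F X\<^esub> e (b, y) = e (a \<oplus>\<^bsub>K\<^esub> b, x \<oplus>\<^bsub>X\<^esub> y)"
  and F_smult:
    "\<lbrakk>a \<in> carrier K; x \<in> carrier X\<rbrakk> \<Longrightarrow> c \<odot>\<^bsub>F X\<^esub> e (a, x) = e (c \<otimes>\<^bsub>K\<^esub> a, c \<odot>\<^bsub>X\<^esub> x)"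
proof -
  have inj: "inj_on e (carrier (adjoin_unit K X))"
    using F_inj by (simp add: adjoin_unit_def)
  have mem: "a \<in> carrier K \<Longrightarrow> x \<in> carrier X \<Longrightarrow> (a, x) \<in> carrier (adjoin_unit K X)" for a x
    by (simp add: adjoin_unit_def)
  note sel = transport_ops[OF inj, folded free_unital_def]
  show "\<lbrakk>a \<in> carrier K; b \<in> carrier K; x \<in> carrier X; y \<in> carrier X\<rbrakk> \<Longrightarrow>
      e (a, x) \<otimes>\<^bsub>F X\<^esub> e (b, y) = e (a \<otimes>\<^bsub>K\<^esub> b, x \<otimes>\<^bsub>X\<^esub> y \<oplus>\<^bsub>X\<^esub> a \<odot>\<^bsub>X\<^esub> y \<oplus>\<^bsub>X\<^esub> b \<odot>\<^bsub>X\<^esub> x)"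
    by (subst sel(1)[OF mem mem]) (simp_all add: adjoin_unit_def)
  show "\<lbrakk>a \<in> carrier K; b \<in> carrier K; x \<in> carrier X; y \<in> carrier X\<rbrakk> \<Longrightarrow>
      e (a, x) \<oplus>\<^bsub>F X\<^esub> e (b, y) = e (a \<oplus>\<^bsub>K\<^esub> b, x \<oplus>\<^bsub>X\<^esub> y)"
    by (subst sel(2)[OF mem mem]) (simp_all add: adjoin_unit_def)
  show "\<lbrakk>a \<in> carrier K; x \<in> carrier X\<rbrakk> \<Longrightarrow> c \<odot>\<^bsub>F X\<^esub> e (a, x) = e (c \<otimes>\<^bsub>K\<^esub> a, c \<odot>\<^bsub>X\<^esub> x)"
    by (subst sel(3)[OF mem]) (simp_all add: adjoin_unit_def)
qed

lemma F_in_variety: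
  assumes "in_variety K \<Phi> X"
  shows "in_variety K \<Phi> (F X)"
  unfolding free_unital_def
  using assms unit_closed F_inj
  by (intro in_variety_transport polys) (auto simp: unit_closed_def adjoin_unit_def)

lemma F_unital:
  assumes "in_variety K \<Phi> X" and z: "z \<in> carrier (F X)"
  shows "\<one>\<^bsub>F X\<^esub> \<otimes>\<^bsub>F X\<^esub> z = z" "z \<otimes>\<^bsub>F X\<^esub> \<one>\<^bsub>F X\<^esub> = z"
proof -
  interpret X: nonassoc_algebra K X using assms by (simp add: in_variety_def)
  have [simp]: "\<zero>\<^bsub>X\<^esub> \<otimes>\<^bsub>X\<^esub> x = \<zero>\<^bsub>X\<^esub>" "x \<otimes>\<^bsub>X\<^esub> \<zero>\<^bsub>X\<^esub> = \<zero>\<^bsub>X\<^esub>" if "x \<in> carrier X" for x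
    using X.mult_smult_left[of "\<zero>\<^bsub>K\<^esub>" x x] X.mult_smult_right[of "\<zero>\<^bsub>K\<^esub>" x x] that
    by (auto simp: X.mult_closed)
  show "\<one>\<^bsub>F X\<^esub> \<otimes>\<^bsub>F X\<^esub> z = z" "z \<otimes>\<^bsub>F X\<^esub> \<one>\<^bsub>F X\<^esub> = z"
    using z by (auto simp: F_carrier F_one F_mult)
qed

end

section \<open>Categories of algebras\<close>

lemma Hom_alg_category:
  "f \<in> Hom (alg_category Ob P) A B \<longleftrightarrow> src f = A \<and> tgt f = B \<and> A \<in> Ob \<and> B \<in> Ob \<and>
     fn f \<in> extensional (carrier A) \<and> P A B (fn f)"
  by (cases f) (auto simp: Hom_def alg_category_def)

lemma alg_category_sel:
  "Obj (alg_category Ob P) = Ob"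
  "Dom (alg_category Ob P) = src"
  "Cod (alg_category Ob P) = tgt"
  "Idt (alg_category Ob P) A = Arrow A (\<lambda>x\<in>carrier A. x) A"
  "g \<cdot>\<^bsub>alg_category Ob P\<^esub> f = Arrow (src f) (compose (carrier (src f)) (fn g) (fn f)) (tgt g)"
  by (simp_all add: alg_category_def)

lemma alg_category_eqI:
  assumes "f \<in> Hom (alg_category Ob P) A B" "g \<in> Hom (alg_category Ob P) A B"
    and "\<And>x. x \<in> carrier A \<Longrightarrow> fn f x = fn g x"
  shows "f = g"
  using assms by (intro arrow.expand) (auto simp: Hom_alg_category intro: extensionalityI)

lemma alg_category_laws:
  assumes P: "\<And>A B h. P A B h \<Longrightarrow> h \<in> carrier A \<rightarrow> carrier B"
    and Id: "\<And>A. A \<in> Ob \<Longrightarrow> P A A (\<lambda>x\<in>carrier A. x)"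
    and comp: "\<And>A B D f g. \<lbrakk>P A B f; P B D g; A \<in> Ob; B \<in> Ob\<rbrakk> \<Longrightarrow> P A D (compose (carrier A) g f)"
  shows "category_laws (alg_category Ob P)"
proof
  fix f g h A B D E
  assume f: "f \<in> Hom (alg_category Ob P) A B" and g: "g \<in> Hom (alg_category Ob P) B D"
  show gf: "g \<cdot>\<^bsub>alg_category Ob P\<^esub> f \<in> Hom (alg_category Ob P) A D"
    using f g comp by (auto simp: Hom_alg_category alg_category_sel)
  assume h: "h \<in> Hom (alg_category Ob P) D E"
  show "h \<cdot>\<^bsub>alg_category Ob P\<^esub> g \<cdot>\<^bsub>alg_category Ob P\<^esub> f
      = (h \<cdot>\<^bsub>alg_category Ob P\<^esub> g) \<cdot>\<^bsub>alg_category Ob P\<^esub> f"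
    using f g h by (auto simp: Hom_alg_category alg_category_sel compose_def Pi_iff intro!: restrict_ext dest!: P)
next
  fix f A B
  assume f: "f \<in> Hom (alg_category Ob P) A B"
  show "f \<cdot>\<^bsub>alg_category Ob P\<^esub> Idt (alg_category Ob P) A = f"
    using f by (cases f) (auto simp: Hom_alg_category alg_category_sel compose_def extensional_def)
  show "Idt (alg_category Ob P) B \<cdot>\<^bsub>alg_category Ob P\<^esub> f = f"
    using f P by (cases f) (auto simp: Hom_alg_category alg_category_sel compose_def extensional_def Pi_def)
next
  fix f assume "f \<in> Arr (alg_category Ob P)"
  then show "Dom (alg_category Ob P) f \<in> Obj (alg_category Ob P) \<and>
      Cod (alg_category Ob P) f \<in> Obj (alg_category Ob P)"
    by (auto simp: alg_category_def)
next
  fix A assume "A \<in> Obj (alg_category Ob P)"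
  then show "Idt (alg_category Ob P) A \<in> Hom (alg_category Ob P) A A"
    using Id by (auto simp: Hom_alg_category alg_category_sel)
qed

context unit_closed_variety
begin

abbreviation V where "V \<equiv> variety K \<Phi>"
abbreviation V\<^sub>1 where "V\<^sub>1 \<equiv> unital_variety K \<Phi>"
abbreviation E where "E \<equiv> unital_context K \<Phi> e"
abbreviation UF where "UF X \<equiv> forget_unit (F X)"
abbreviation UFa where "UFa f \<equiv> Ua E (Fa E f)"
abbreviation \<eta> where "\<eta> \<equiv> eta E"

sublocale category_laws "variety K \<Phi>"
  unfolding variety_def
  by (rule alg_category_laws)
    (auto simp: alg_hom_def in_variety_def compose_def Pi_def nonassoc_algebra.mult_closed
      abelian_monoid.a_closed[OF abelian_group.axioms(1)[OF module.axioms(2)[OF nonassoc_algebra.axioms(2)]]]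
      module.smult_closed[OF nonassoc_algebra.axioms(2)])

lemma V_Obj: "A \<in> Obj V \<longleftrightarrow> in_variety K \<Phi> A \<and> one A = undefined"
  by (simp add: variety_def alg_category_sel)

lemma V_Obj_algebra: "A \<in> Obj V \<Longrightarrow> nonassoc_algebra K A"
  by (simp add: V_Obj in_variety_def)

lemma V_Hom: "f \<in> Hom V A B \<longleftrightarrow> src f = A \<and> tgt f = B \<and> A \<in> Obj V \<and> B \<in> Obj V \<and>
     fn f \<in> extensional (carrier A) \<and> alg_hom K A B (fn f)"
  by (simp add: variety_def Hom_alg_category alg_category_sel)

lemma V_sel: "Dom V = src" "Cod V = tgt" "Idt V A = Arrow A (\<lambda>x\<in>carrier A. x) A"
  by (simp_all add: variety_def alg_category_sel)

lemma V_eqI: "\<lbrakk>f \<in> Hom V A B; g \<in> Hom V A B; \<And>x. x \<in> carrier A \<Longrightarrow> fn f x = fn g x\<rbrakk> \<Longrightarrow> f = g"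
  unfolding variety_def by (rule alg_category_eqI)

lemma fn_Cmp: "\<lbrakk>f \<in> Hom V A B; x \<in> carrier A\<rbrakk> \<Longrightarrow> fn (g \<cdot>\<^bsub>V\<^esub> f) x = fn g (fn f x)"
  by (simp add: variety_def alg_category_sel Hom_alg_category compose_def)

lemma fn_hom:
  assumes "f \<in> Hom V A B"
  shows "x \<in> carrier A \<Longrightarrow> fn f x \<in> carrier B"
    and "\<lbrakk>x \<in> carrier A; y \<in> carrier A\<rbrakk> \<Longrightarrow> fn f (x \<oplus>\<^bsub>A\<^esub> y) = fn f x \<oplus>\<^bsub>B\<^esub> fn f y"
    and "\<lbrakk>a \<in> carrier K; x \<in> carrier A\<rbrakk> \<Longrightarrow> fn f (a \<odot>\<^bsub>A\<^esub> x) = a \<odot>\<^bsub>B\<^esub> fn f x"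
    and "\<lbrakk>x \<in> carrier A; y \<in> carrier A\<rbrakk> \<Longrightarrow> fn f (x \<otimes>\<^bsub>A\<^esub> y) = fn f x \<otimes>\<^bsub>B\<^esub> fn f y"
  using assms alg_homD[of K A B "fn f"] by (auto simp: V_Hom)

lemma fn_zero: "f \<in> Hom V A B \<Longrightarrow> fn f \<zero>\<^bsub>A\<^esub> = \<zero>\<^bsub>B\<^esub>"
  using alg_hom_zero[of K A B "fn f"] V_Obj_algebra by (auto simp: V_Hom)

lemma V\<^sub>1_Obj: "B \<in> Obj V\<^sub>1 \<longleftrightarrow> in_variety K \<Phi> B \<and> \<one>\<^bsub>B\<^esub> \<in> carrier B \<and>
    (\<forall>x\<in>carrier B. \<one>\<^bsub>B\<^esub> \<otimes>\<^bsub>B\<^esub> x = x \<and> x \<otimes>\<^bsub>B\<^esub> \<one>\<^bsub>B\<^esub> = x)"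
  by (simp add: unital_variety_def alg_category_sel)

lemma V\<^sub>1_Hom: "f \<in> Hom V\<^sub>1 A B \<longleftrightarrow> src f = A \<and> tgt f = B \<and> A \<in> Obj V\<^sub>1 \<and> B \<in> Obj V\<^sub>1 \<and>
     fn f \<in> extensional (carrier A) \<and> alg_hom K A B (fn f) \<and> fn f \<one>\<^bsub>A\<^esub> = \<one>\<^bsub>B\<^esub>"
  by (auto simp: unital_variety_def Hom_alg_category alg_category_sel)

lemma V\<^sub>1_sel: "Dom V\<^sub>1 = src" "Cod V\<^sub>1 = tgt" "Idt V\<^sub>1 A = Arrow A (\<lambda>x\<in>carrier A. x) A"
  "g \<cdot>\<^bsub>V\<^sub>1\<^esub> f = Arrow (src f) (compose (carrier (src f)) (fn g) (fn f)) (tgt g)"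
  by (simp_all add: unital_variety_def alg_category_sel)

lemma V\<^sub>1_eqI: "\<lbrakk>f \<in> Hom V\<^sub>1 A B; g \<in> Hom V\<^sub>1 A B; \<And>x. x \<in> carrier A \<Longrightarrow> fn f x = fn g x\<rbrakk> \<Longrightarrow> f = g"
  unfolding unital_variety_def by (rule alg_category_eqI)

lemma E_sel: "catV E = V" "catU E = V\<^sub>1" "Uo E = forget_unit" "Fo E = F"
  "Ua E f = Arrow (forget_unit (src f)) (fn f) (forget_unit (tgt f))"
  by (simp_all add: unital_context_def)

lemma forget_unit_sel [simp]:
  "carrier (forget_unit A) = carrier A" "zero (forget_unit A) = zero A" "add (forget_unit A) = add A"
  "smult (forget_unit A) = smult A" "mult (forget_unit A) = mult A" "one (forget_unit A) = undefined"
  by (simp_all add: forget_unit_def)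

lemma alg_hom_forget_unit [simp]:
  "alg_hom K (forget_unit A) B h \<longleftrightarrow> alg_hom K A B h"
  "alg_hom K A (forget_unit B) h \<longleftrightarrow> alg_hom K A B h"
  by (simp_all add: alg_hom_def)

lemma forget_unit_Obj: "in_variety K \<Phi> B \<Longrightarrow> forget_unit B \<in> Obj V"
  using in_variety_one_update[OF _ polys] by (simp add: V_Obj forget_unit_def)

lemma Ua_Hom:
  assumes "f \<in> Hom V\<^sub>1 A B"
  shows "Ua E f \<in> Hom V (forget_unit A) (forget_unit B)"
  using assms forget_unit_Obj by (auto simp: V_Hom V\<^sub>1_Hom V\<^sub>1_Obj E_sel)

lemma F_Obj:
  assumes X: "X \<in> Obj V"
  shows "F X \<in> Obj V\<^sub>1"
proof -
  interpret X: nonassoc_algebra K X using X V_Obj_algebra by blast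
  have "\<one>\<^bsub>F X\<^esub> \<in> carrier (F X)" by (simp add: F_one F_carrier)
  then show ?thesis using X F_in_variety F_unital by (simp add: V\<^sub>1_Obj V_Obj)
qed

lemma UF_Obj: "X \<in> Obj V \<Longrightarrow> UF X \<in> Obj V"
  using F_Obj forget_unit_Obj V\<^sub>1_Obj by blast

lemma fn_UFa:
  assumes "f \<in> Hom V X Y" "a \<in> carrier K" "x \<in> carrier X"
  shows "fn (UFa f) (e (a, x)) = e (a, fn f x)"
  using assms by (auto simp: V_Hom unital_context_def F_carrier inv_into_f_f[OF F_inj])

lemma UFa_Hom:
  assumes f: "f \<in> Hom V X Y"
  shows "UFa f \<in> Hom V (UF X) (UF Y)"
proof -
  have XY: "src f = X" "tgt f = Y" "X \<in> Obj V" "Y \<in> Obj V" using f by (auto simp: V_Hom)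
  interpret X: nonassoc_algebra K X using XY V_Obj_algebra by blast
  interpret Y: nonassoc_algebra K Y using XY V_Obj_algebra by blast
  have src: "src (UFa f) = UF X" "tgt (UFa f) = UF Y" "fn (UFa f) \<in> extensional (carrier (F X))"
    by (simp_all add: unital_context_def XY)
  have "alg_hom K (F X) (F Y) (fn (UFa f))"
    unfolding alg_hom_def F_carrier
    by (auto simp: fn_UFa[OF f] F_add F_mult F_smult fn_hom[OF f] X.mult_closed)
  then show ?thesis using src XY UF_Obj by (simp add: V_Hom)
qed

lemma fn_\<eta>: "x \<in> carrier X \<Longrightarrow> fn (\<eta> X) x = e (\<zero>\<^bsub>K\<^esub>, x)"
  by (simp add: unital_context_def)

lemma \<eta>_Hom:
  assumes X: "X \<in> Obj V"
  shows "\<eta> X \<in> Hom V X (UF X)"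
proof -
  interpret X: nonassoc_algebra K X using X V_Obj_algebra by blast
  have "alg_hom K X (F X) (fn (\<eta> X))"
    by (auto simp: alg_hom_def fn_\<eta> F_add F_mult F_smult F_carrier X.mult_closed)
  then show ?thesis using X UF_Obj by (simp add: V_Hom) (simp add: unital_context_def)
qed

end


section \<open>Kernels in a variety\<close>

locale unit_closed_variety_with_choice =
  unit_closed_variety K \<Phi> e + category_with_choice "variety K \<Phi>" S
  for K :: "'k ring" and \<Phi> and e :: "'k \<times> 'a \<Rightarrow> 'a"
    and S :: "(('k, 'a) module, (('k, 'a) module, 'a) arrow) choice"
begin

lemma zero_map_Hom:
  assumes "A \<in> Obj V" "B \<in> Obj V"
  shows "Arrow A (\<lambda>x\<in>carrier A. \<zero>\<^bsub>B\<^esub>) B \<in> Hom V A B"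
proof -
  interpret A: nonassoc_algebra K A using assms V_Obj_algebra by blast
  interpret B: nonassoc_algebra K B using assms V_Obj_algebra by blast
  have "\<zero>\<^bsub>B\<^esub> \<otimes>\<^bsub>B\<^esub> \<zero>\<^bsub>B\<^esub> = \<zero>\<^bsub>B\<^esub>"
    using B.mult_smult_left[of "\<zero>\<^bsub>K\<^esub>" "\<zero>\<^bsub>B\<^esub>" "\<zero>\<^bsub>B\<^esub>"] by (simp add: B.mult_closed)
  with assms show ?thesis by (auto simp: V_Hom alg_hom_def A.mult_closed)
qed

text \<open>The identity of a zero object agrees with its zero map.\<close>

lemma zob_carrier: "x \<in> carrier (zob S) \<Longrightarrow> x = \<zero>\<^bsub>zob S\<^esub>"
proof -
  assume x: "x \<in> carrier (zob S)"
  have "Idt V (zob S) = Arrow (zob S) (\<lambda>x\<in>carrier (zob S). \<zero>\<^bsub>zob S\<^esub>) (zob S)"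
    using ex1_to_zob[OF zob_Obj] Idt_Hom[OF zob_Obj] zero_map_Hom[OF zob_Obj zob_Obj] by blast
  then have "(\<lambda>x\<in>carrier (zob S). x) = (\<lambda>x\<in>carrier (zob S). \<zero>\<^bsub>zob S\<^esub>)"
    by (simp add: V_sel)
  from fun_cong[OF this, of x] x show ?thesis by simp
qed

lemma fn_zero_arr:
  assumes A: "A \<in> Obj V" and B: "B \<in> Obj V" and x: "x \<in> carrier A"
  shows "fn (zero_arr V (zob S) A B) x = \<zero>\<^bsub>B\<^esub>"
  unfolding zero_arr_def
  using fn_Cmp[OF unique_arr_to_zob[OF A] x] zob_carrier[OF fn_hom(1)[OF unique_arr_to_zob[OF A] x]]
    fn_zero[OF unique_arr_from_zob[OF B]] by simp

text \<open>Varieties are closed under subalgebras, so the universal property of a categorical kernel can be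
  tested on the inclusion of the set of elements which \<open>p\<close> sends to zero.\<close>

lemma kernel_surj:
  assumes k: "is_kernel V (zob S) N k p" and p: "p \<in> Hom V A B"
    and a: "a \<in> carrier A" "fn p a = \<zero>\<^bsub>B\<^esub>"
  obtains n where "n \<in> carrier N" "fn k n = a"
proof -
  have AB: "A \<in> Obj V" "B \<in> Obj V" using p by (auto simp: V_Hom)
  interpret A: nonassoc_algebra K A using AB V_Obj_algebra by blast
  interpret B: nonassoc_algebra K B using AB V_Obj_algebra by blast
  have mult0: "x \<otimes>\<^bsub>B\<^esub> \<zero>\<^bsub>B\<^esub> = \<zero>\<^bsub>B\<^esub>" if "x \<in> carrier B" for x
    using B.mult_smult_right[of "\<zero>\<^bsub>K\<^esub>" x x] that by (simp add: B.mult_closed)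
  define W where "W = A\<lparr>carrier := {x \<in> carrier A. fn p x = \<zero>\<^bsub>B\<^esub>}\<rparr>"
  define i where "i = Arrow W (\<lambda>x\<in>carrier W. x) A"
  have "in_variety K \<Phi> W"
    by (rule in_variety_if_embeds[where B = A and h = "\<lambda>x. x"])
      (use AB polys in \<open>auto simp: V_Obj W_def alg_hom_def fn_zero[OF p] fn_hom[OF p] A.mult_closed mult0\<close>)
  then have W: "W \<in> Obj V" using AB by (auto simp: V_Obj W_def)
  interpret W: nonassoc_algebra K W using W V_Obj_algebra by blast
  have i: "i \<in> Hom V W A"
    using W AB W.M.a_closed W.mult_closed W.smult_closed by (auto simp: i_def V_Hom alg_hom_def W_def)
  have "p \<cdot>\<^bsub>V\<^esub> i = zero_arr V (zob S) W B"
    by (rule V_eqI[OF Cmp_Hom[OF i p] zero_arr_Hom[OF W AB(2)]])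
      (auto simp: fn_Cmp[OF i] fn_zero_arr W AB, auto simp: i_def W_def)
  then obtain g where g: "g \<in> Hom V W N" "k \<cdot>\<^bsub>V\<^esub> g = i"
    using kernelD(4)[OF k p i] by blast
  have aW: "a \<in> carrier W" using a by (simp add: W_def)
  show thesis
  proof
    show "fn g a \<in> carrier N" using fn_hom(1)[OF g(1) aW] .
    show "fn k (fn g a) = a" using fn_Cmp[OF g(1) aW, of k] g(2) aW by (simp add: i_def)
  qed
qed

lemma is_kernelI:
  assumes k: "k \<in> Hom V N A" and p: "p \<in> Hom V A B" and inj: "inj_on (fn k) (carrier N)"
    and im: "fn k ` carrier N = {a \<in> carrier A. fn p a = \<zero>\<^bsub>B\<^esub>}"
  shows "is_kernel V (zob S) N k p"
proof -
  have O: "N \<in> Obj V" "A \<in> Obj V" "B \<in> Obj V" using k p by (auto simp: V_Hom)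
  have pk: "p \<cdot>\<^bsub>V\<^esub> k = zero_arr V (zob S) N B"
    by (rule V_eqI[OF Cmp_Hom[OF k p] zero_arr_Hom[OF O(1,3)]])
      (use im in \<open>auto simp: fn_Cmp[OF k] fn_zero_arr O\<close>)
  have "\<exists>!g. g \<in> Hom V W N \<and> k \<cdot>\<^bsub>V\<^esub> g = f"
    if W: "W \<in> Obj V" and f: "f \<in> Hom V W A" and pf: "p \<cdot>\<^bsub>V\<^esub> f = zero_arr V (zob S) W B" for W f
  proof (rule ex_ex1I)
    interpret W: nonassoc_algebra K W using W V_Obj_algebra by blast
    interpret N: nonassoc_algebra K N using O V_Obj_algebra by blast
    have mem: "fn f x \<in> fn k ` carrier N" if x: "x \<in> carrier W" for x
      unfolding im using x fn_hom(1)[OF f x] fn_Cmp[OF f x, of p] pf fn_zero_arr[OF W O(3) x] by simp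
    define g where "g = Arrow W (\<lambda>x\<in>carrier W. inv_into (carrier N) (fn k) (fn f x)) N"
    have gN: "fn g x \<in> carrier N" and kg: "fn k (fn g x) = fn f x" if "x \<in> carrier W" for x
      using that inv_into_into[OF mem[OF that]] f_inv_into_f[OF mem[OF that]] by (simp_all add: g_def)
    have eqI: "fn g x = n" if "x \<in> carrier W" "n \<in> carrier N" "fn f x = fn k n" for x n
      using inj_onD[OF inj _ gN[OF that(1)] that(2)] kg that by simp
    have "alg_hom K W N (fn g)"
      by (auto simp: alg_hom_def gN kg fn_hom[OF f] fn_hom[OF k] N.mult_closed W.mult_closed intro!: eqI)
    then have g: "g \<in> Hom V W N"
      using W O by (simp add: V_Hom) (simp add: g_def)
    have "k \<cdot>\<^bsub>V\<^esub> g = f"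
      by (rule V_eqI[OF Cmp_Hom[OF g k] f]) (simp add: fn_Cmp[OF g] kg)
    with g show "\<exists>g. g \<in> Hom V W N \<and> k \<cdot>\<^bsub>V\<^esub> g = f" by blast
  next
    fix g g' assume *: "g \<in> Hom V W N \<and> k \<cdot>\<^bsub>V\<^esub> g = f" "g' \<in> Hom V W N \<and> k \<cdot>\<^bsub>V\<^esub> g' = f"
    then have g: "g \<in> Hom V W N" "g' \<in> Hom V W N" by auto
    show "g = g'"
    proof (rule V_eqI[OF g])
      fix x assume x: "x \<in> carrier W"
      have "fn k (fn g x) = fn k (fn g' x)"
        using fn_Cmp[OF g(1) x, of k] fn_Cmp[OF g(2) x, of k] * by simp
      then show "fn g x = fn g' x"
        using inj_onD[OF inj] fn_hom(1)[OF g(1) x] fn_hom(1)[OF g(2) x] by blast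
    qed
  qed
  moreover have "p \<in> Arr V" "Dom V p = A" "Cod V p = B" using HomD[OF p] by auto
  ultimately show ?thesis using k pk O by (simp add: is_kernel_def)
qed

text \<open>The point \<open>UF(X) \<rightarrow> UF(0)\<close> has kernel \<open>\<eta>\<close>, because \<open>UF(\<tau>)\<close> sends \<open>(a, x)\<close> to \<open>(a, 0)\<close>. Its
  action is \<open>\<xi>\<^sub>0\<close>.\<close>

lemma xi0:
  assumes X: "X \<in> Obj V"
  defines "i \<equiv> UFa (unique_arr V (zob S) X)"
  shows xi0_Hom: "xi0 E S X \<in> Hom V (flat S (UF (zob S)) X) X"
    and \<eta>_xi0: "\<eta> X \<cdot>\<^bsub>V\<^esub> xi0 E S X = copair V S i (\<eta> X) \<cdot>\<^bsub>V\<^esub> kap S (UF (zob S)) X"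
proof -
  let ?Z = "zob S" and ?r = "UFa (unique_arr V X (zob S))"
  note \<iota> = unique_arr_from_zob[OF X] and \<tau> = unique_arr_to_zob[OF X]
  have i: "i \<in> Hom V (UF ?Z) (UF X)" unfolding i_def by (rule UFa_Hom[OF \<iota>])
  have r: "?r \<in> Hom V (UF X) (UF ?Z)" by (rule UFa_Hom[OF \<tau>])
  note eta = \<eta>_Hom[OF X]
  have Z0: "fn (unique_arr V X ?Z) x = \<zero>\<^bsub>?Z\<^esub>" if "x \<in> carrier X" for x
    using zob_carrier[OF fn_hom(1)[OF \<tau> that]] .
  have ri: "?r \<cdot>\<^bsub>V\<^esub> i = Idt V (UF ?Z)"
  proof (rule V_eqI[OF Cmp_Hom[OF i r] Idt_Hom[OF UF_Obj[OF zob_Obj]]])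
    fix z assume z: "z \<in> carrier (UF ?Z)"
    then obtain a x where ax: "z = e (a, x)" "a \<in> carrier K" "x \<in> carrier ?Z"
      by (auto simp: F_carrier)
    have "fn (unique_arr V X ?Z) (fn (unique_arr V ?Z X) x) = x"
      using Z0[OF fn_hom(1)[OF \<iota> ax(3)]] zob_carrier[OF ax(3)] by simp
    then show "fn (?r \<cdot>\<^bsub>V\<^esub> i) z = fn (Idt V (UF ?Z)) z"
      using z ax fn_hom(1)[OF \<iota>] by (simp add: fn_Cmp[OF i[unfolded i_def]] i_def fn_UFa[OF \<iota>] fn_UFa[OF \<tau>] V_sel)
  qed
  interpret Z: nonassoc_algebra K ?Z using zob_Obj V_Obj_algebra by blast
  have e_eq: "e (a, x) = e (b, y) \<longleftrightarrow> a = b \<and> x = y" if "a \<in> carrier K" "b \<in> carrier K" for a b x y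
    using inj_e that by (auto dest: inj_onD)
  have "is_kernel V ?Z X (\<eta> X) ?r"
  proof (rule is_kernelI[OF eta r])
    show "inj_on (fn (\<eta> X)) (carrier X)"
      by (rule inj_onI) (simp add: fn_\<eta> e_eq)
    show "fn (\<eta> X) ` carrier X = {a \<in> carrier (UF X). fn ?r a = \<zero>\<^bsub>UF ?Z\<^esub>}"
      by (force simp: fn_\<eta> F_carrier F_zero fn_UFa[OF \<tau>] Z0 e_eq)
  qed
  from ex1_action_of_point[OF r i ri this]
  have ex1: "\<exists>!\<xi>. \<xi> \<in> Hom V (flat S (UF ?Z) X) X \<and>
      \<eta> X \<cdot>\<^bsub>V\<^esub> \<xi> = copair V S i (\<eta> X) \<cdot>\<^bsub>V\<^esub> kap S (UF ?Z) X" .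
  have eq: "xi0 E S X = (THE \<xi>. \<xi> \<in> Hom V (flat S (UF ?Z) X) X \<and>
      \<eta> X \<cdot>\<^bsub>V\<^esub> \<xi> = copair V S i (\<eta> X) \<cdot>\<^bsub>V\<^esub> kap S (UF ?Z) X)"
    unfolding xi0_def Let_def i_def by (simp only: E_sel(1,3,4))
  show "xi0 E S X \<in> Hom V (flat S (UF ?Z) X) X"
      "\<eta> X \<cdot>\<^bsub>V\<^esub> xi0 E S X = copair V S i (\<eta> X) \<cdot>\<^bsub>V\<^esub> kap S (UF ?Z) X"
    unfolding eq using theI'[OF ex1] by auto
qed

end

section \<open>Coherent actions and units\<close>

context unit_closed_variety_with_choice
begin

text \<open>The underlying algebra of \<open>F(0)\<close> is the line spanned by its unit, so the image of the unit
  determines a morphism of unital algebras; the morphism sends \<open>(a, 0)\<close> to \<open>a 1\<^sub>B\<close>.\<close>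

lemma F_zob_initial:
  assumes B: "B \<in> Obj V\<^sub>1"
  shows "\<exists>!f. f \<in> Hom V\<^sub>1 (F (zob S)) B"
proof -
  let ?Z = "zob S"
  interpret Z: nonassoc_algebra K ?Z using zob_Obj V_Obj_algebra by blast
  interpret B: nonassoc_algebra K B using B by (simp add: V\<^sub>1_Obj in_variety_def)
  have unit: "\<one>\<^bsub>B\<^esub> \<otimes>\<^bsub>B\<^esub> x = x" if "x \<in> carrier B" for x
    using B that by (auto simp: V\<^sub>1_Obj)
  define \<iota> where "\<iota> = Arrow (F ?Z)
    (\<lambda>z\<in>carrier (F ?Z). fst (inv_into (carrier K \<times> carrier ?Z) e z) \<odot>\<^bsub>B\<^esub> \<one>\<^bsub>B\<^esub>) B"
  have oneB: "\<one>\<^bsub>B\<^esub> \<in> carrier B" using B by (simp add: V\<^sub>1_Obj)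
  have fn: "fn \<iota> (e (a, x)) = a \<odot>\<^bsub>B\<^esub> \<one>\<^bsub>B\<^esub>" if "a \<in> carrier K" "x \<in> carrier ?Z" for a x
    using that by (auto simp: \<iota>_def F_carrier inv_into_f_f[OF F_inj])
  have "alg_hom K (F ?Z) B (fn \<iota>)"
    by (auto simp: alg_hom_def F_carrier F_add F_mult F_smult fn oneB unit B.smult_l_distr
        B.smult_assoc1 B.mult_smult_left Z.mult_closed)
  moreover have "fn \<iota> \<one>\<^bsub>F ?Z\<^esub> = \<one>\<^bsub>B\<^esub>"
    by (simp add: F_one fn oneB)
  ultimately have \<iota>: "\<iota> \<in> Hom V\<^sub>1 (F ?Z) B"
    using B F_Obj[OF zob_Obj] by (simp add: V\<^sub>1_Hom) (simp add: \<iota>_def)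
  show ?thesis
  proof (rule ex1I[where a = \<iota>], rule \<iota>)
    fix f assume f: "f \<in> Hom V\<^sub>1 (F ?Z) B"
    show "f = \<iota>"
    proof (rule V\<^sub>1_eqI[OF f \<iota>])
      fix z assume "z \<in> carrier (F ?Z)"
      then obtain a where a: "a \<in> carrier K" and z: "z = e (a, \<zero>\<^bsub>?Z\<^esub>)"
        by (auto simp: F_carrier dest!: zob_carrier)
      have one_carrier: "\<one>\<^bsub>F ?Z\<^esub> \<in> carrier (F ?Z)" by (simp add: F_one F_carrier)
      have "z = a \<odot>\<^bsub>F ?Z\<^esub> \<one>\<^bsub>F ?Z\<^esub>"
        using a by (simp add: z F_one F_smult)
      then have "fn f z = a \<odot>\<^bsub>B\<^esub> \<one>\<^bsub>B\<^esub>"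
        using a f one_carrier alg_homD(3)[of K "F ?Z" B "fn f" a "\<one>\<^bsub>F ?Z\<^esub>"]
        by (simp add: V\<^sub>1_Hom)
      then show "fn f z = fn \<iota> z" using a by (simp add: z fn)
    qed
  qed
qed

text \<open>In \<open>UF(0) + X\<close> the product of \<open>i\<^sub>1(1)\<close> and \<open>i\<^sub>2(x)\<close> lies in the ideal \<open>UF(0)\<flat>X\<close>, and \<open>\<xi>\<^sub>0\<close> sends
  it to \<open>1 \<cdot> x = x\<close>, computed in \<open>UF(X)\<close>. Coherence identifies \<open>\<xi>\<^sub>0\<close> with the restriction of the
  given action along \<open>UF(0) \<rightarrow> U(B)\<close>, under which the same element goes to \<open>s(1) \<cdot> x\<close>, computed in
  the domain of the point.\<close>

lemma coherent_one_acts_trivially: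
  assumes act: "relative_action E S B X \<xi>" and coh: "coherent E S B X \<xi>"
    and assoc: "associated_via V S (forget_unit B) X \<xi> p s k"
    and x: "x \<in> carrier X"
  shows "fn s \<one>\<^bsub>B\<^esub> \<otimes>\<^bsub>src p\<^esub> fn k x = fn k x" "fn k x \<otimes>\<^bsub>src p\<^esub> fn s \<one>\<^bsub>B\<^esub> = fn k x"
proof -
  let ?Z = "zob S" and ?C = "forget_unit B" and ?A = "src p"
  let ?W = "UF ?Z" and ?u = "\<one>\<^bsub>F ?Z\<^esub>"
  define g where "g = Ua E (unique_arr V\<^sub>1 (F ?Z) B)"
  define i where "i = UFa (unique_arr V ?Z X)"
  have B: "B \<in> Obj V\<^sub>1" and X: "X \<in> Obj V" and \<xi>: "\<xi> \<in> Hom V (flat S ?C X) X"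
    using act by (auto simp: relative_action_def internal_action_def E_sel)
  note \<iota> = theI'[OF F_zob_initial[OF B], folded unique_arr_def]
  have g: "g \<in> Hom V ?W ?C" unfolding g_def by (rule Ua_Hom[OF \<iota>])
  have g1: "fn g ?u = \<one>\<^bsub>B\<^esub>" using \<iota> by (simp add: g_def E_sel V\<^sub>1_Hom)
  have s: "s \<in> Hom V ?C ?A" and p: "p \<in> Hom V ?A ?C"
    and ker: "is_kernel V ?Z X k p" and k\<xi>: "k \<cdot>\<^bsub>V\<^esub> \<xi> = copair V S s k \<cdot>\<^bsub>V\<^esub> kap S ?C X"
    using assoc by (auto simp: associated_via_def is_point_def Hom_def V_sel)
  note k = kernelD(2)[OF ker p]
  note \<eta>X = \<eta>_Hom[OF X] and x0 = xi0[OF X, folded i_def] and \<iota>X = unique_arr_from_zob[OF X]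
  have W: "?W \<in> Obj V" using UF_Obj[OF zob_Obj] .
  have i: "i \<in> Hom V ?W (UF X)" unfolding i_def by (rule UFa_Hom[OF \<iota>X])
  interpret Z: nonassoc_algebra K ?Z using zob_Obj V_Obj_algebra by blast
  interpret X: nonassoc_algebra K X using X V_Obj_algebra by blast
  interpret W: nonassoc_algebra K ?W using W V_Obj_algebra by blast
  have u: "?u \<in> carrier ?W" by (simp add: F_one F_carrier)
  have i1: "fn i ?u = \<one>\<^bsub>F X\<^esub>"
    by (simp add: i_def F_one fn_UFa[OF \<iota>X] fn_zero[OF \<iota>X])
  have sg: "s \<cdot>\<^bsub>V\<^esub> g \<in> Hom V ?W ?A" by (rule Cmp_Hom[OF g s])
  have kx0: "k \<cdot>\<^bsub>V\<^esub> xi0 E S X = copair V S (s \<cdot>\<^bsub>V\<^esub> g) k \<cdot>\<^bsub>V\<^esub> kap S ?W X"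
    using restricted_action[OF g s k \<xi> k\<xi>] coh by (simp add: coherent_def E_sel(1,2,4) g_def)
  let ?P = "cop S ?W X" and ?r = "copair V S (Idt V ?W) (zero_arr V ?Z X ?W)"
  note in1 = in_Hom(1)[OF W X] and in2 = in_Hom(2)[OF W X]
  define a where "a = fn (in1 S ?W X) ?u"
  define b where "b = fn (in2 S ?W X) x"
  have P: "nonassoc_algebra K ?P" using in1 V_Obj_algebra by (auto simp: V_Hom)
  have ab: "a \<in> carrier ?P" "b \<in> carrier ?P"
    using fn_hom(1)[OF in1 u] fn_hom(1)[OF in2 x] by (simp_all add: a_def b_def)
  have copair_ab: "fn (copair V S f h) a = fn f ?u" "fn (copair V S f h) b = fn h x"
    if "f \<in> Hom V ?W D" "h \<in> Hom V X D" for f h D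
    using fn_Cmp[OF in1 u, of "copair V S f h"] fn_Cmp[OF in2 x, of "copair V S f h"]
      copair_in1[OF that] copair_in2[OF that] by (simp_all add: a_def b_def)
  have r: "?r \<in> Hom V ?P ?W" by (rule retraction_Hom[OF W X])
  have rb: "fn ?r b = \<zero>\<^bsub>?W\<^esub>"
    using copair_ab(2)[OF Idt_Hom[OF W] zero_arr_Hom[OF X W]] fn_zero_arr[OF X W x] by simp
  have mult0: "y \<otimes>\<^bsub>?W\<^esub> \<zero>\<^bsub>?W\<^esub> = \<zero>\<^bsub>?W\<^esub>" "\<zero>\<^bsub>?W\<^esub> \<otimes>\<^bsub>?W\<^esub> y = \<zero>\<^bsub>?W\<^esub>" if "y \<in> carrier ?W" for y
    using W.mult_smult_right[of "\<zero>\<^bsub>K\<^esub>" y y] W.mult_smult_left[of "\<zero>\<^bsub>K\<^esub>" y y]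
      W.smult_l_null[OF that] W.smult_l_null[OF W.mult_closed[OF that that]] that
    by simp_all
  have ra: "fn ?r a \<in> carrier ?W" using fn_hom(1)[OF r ab(1)] .
  \<comment> \<open>The preimage of \<open>w\<close> in \<open>UF(0)\<flat>X\<close> is mapped to \<open>x\<close> by \<open>\<xi>\<^sub>0\<close>, as one sees in \<open>UF(X)\<close> since \<open>\<eta>\<close> is
    injective. By coherence the domain of \<open>p\<close> receives \<open>k(x)\<close>.\<close>
  have transfer: "fn k x = fn (copair V S (s \<cdot>\<^bsub>V\<^esub> g) k) w"
    if w: "w \<in> carrier ?P" "fn ?r w = \<zero>\<^bsub>?W\<^esub>" "fn (copair V S i (\<eta> X)) w = fn (\<eta> X) x" for w
  proof -
    note K = kap_Hom[OF W X]
    obtain v where v: "v \<in> carrier (flat S ?W X)" "fn (kap S ?W X) v = w"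
      using kernel_surj[OF kap_kernel[OF W X] r w(1,2)] .
    have \<xi>v: "fn (xi0 E S X) v \<in> carrier X" using fn_hom(1)[OF x0(1) v(1)] .
    have "fn (\<eta> X) (fn (xi0 E S X) v) = fn (\<eta> X) x"
      using fn_Cmp[OF x0(1) v(1), of "\<eta> X"] fn_Cmp[OF K v(1), of "copair V S i (\<eta> X)"] x0(2) v(2) w(3)
      by simp
    then have "fn (xi0 E S X) v = x"
      using inj_e \<xi>v x by (auto simp: fn_\<eta> dest: inj_onD)
    then show ?thesis
      using fn_Cmp[OF x0(1) v(1), of k] fn_Cmp[OF K v(1), of "copair V S (s \<cdot>\<^bsub>V\<^esub> g) k"] kx0 v(2)
      by simp
  qed
  note i\<eta> = copair_Hom[OF i \<eta>X] and sgk = copair_Hom[OF sg k]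
  have \<eta>x: "fn (\<eta> X) x \<in> carrier (F X)" using fn_hom(1)[OF \<eta>X x] by simp
  have s1: "fn (s \<cdot>\<^bsub>V\<^esub> g) ?u = fn s \<one>\<^bsub>B\<^esub>" using fn_Cmp[OF g u] g1 by simp
  have XV: "in_variety K \<Phi> X" using X by (simp add: V_Obj)
  note unit = F_unital[OF XV \<eta>x]
  note abm = nonassoc_algebra.mult_closed[OF P ab] nonassoc_algebra.mult_closed[OF P ab(2,1)]
  have "fn k x = fn (copair V S (s \<cdot>\<^bsub>V\<^esub> g) k) (a \<otimes>\<^bsub>?P\<^esub> b)"
    by (rule transfer[OF abm(1)])
      (use ra unit in \<open>simp_all only: fn_hom(4)[OF r ab] fn_hom(4)[OF i\<eta> ab] rb mult0[unfolded forget_unit_sel]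
          copair_ab[OF i \<eta>X] i1 forget_unit_sel\<close>)
  then show "fn s \<one>\<^bsub>B\<^esub> \<otimes>\<^bsub>?A\<^esub> fn k x = fn k x"
    by (simp add: fn_hom(4)[OF sgk ab] copair_ab[OF sg k] s1)
  have "fn k x = fn (copair V S (s \<cdot>\<^bsub>V\<^esub> g) k) (b \<otimes>\<^bsub>?P\<^esub> a)"
    by (rule transfer[OF abm(2)])
      (use ra unit in \<open>simp_all only: fn_hom(4)[OF r ab(2,1)] fn_hom(4)[OF i\<eta> ab(2,1)] rb mult0[unfolded forget_unit_sel]
          copair_ab[OF i \<eta>X] i1 forget_unit_sel\<close>)
  then show "fn k x \<otimes>\<^bsub>?A\<^esub> fn s \<one>\<^bsub>B\<^esub> = fn k x"
    by (simp add: fn_hom(4)[OF sgk ab(2,1)] copair_ab[OF sg k] s1)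
qed

text \<open>As a vector space the domain of the point is \<open>s(B) + k(X)\<close>, so \<open>s(1)\<close> is a unit as soon as it
  acts trivially on the kernel.\<close>

lemma coherent_point_unital:
  assumes act: "relative_action E S B X \<xi>" and coh: "coherent E S B X \<xi>"
    and assoc: "associated_via V S (forget_unit B) X \<xi> p s k"
    and a: "a \<in> carrier (src p)"
  shows "fn s \<one>\<^bsub>B\<^esub> \<otimes>\<^bsub>src p\<^esub> a = a" "a \<otimes>\<^bsub>src p\<^esub> fn s \<one>\<^bsub>B\<^esub> = a"
proof -
  let ?C = "forget_unit B" and ?A = "src p"
  have B: "B \<in> Obj V\<^sub>1" using act by (simp add: relative_action_def E_sel)
  have s: "s \<in> Hom V ?C ?A" and p: "p \<in> Hom V ?A ?C" and ps: "p \<cdot>\<^bsub>V\<^esub> s = Idt V ?C"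
    and ker: "is_kernel V (zob S) X k p"
    using assoc by (auto simp: associated_via_def is_point_def Hom_def V_sel)
  interpret A: nonassoc_algebra K ?A using s V_Obj_algebra by (auto simp: V_Hom)
  interpret C: nonassoc_algebra K ?C using s V_Obj_algebra by (auto simp: V_Hom)
  define c where "c = fn p a"
  have c: "c \<in> carrier ?C" using fn_hom(1)[OF p a] by (simp only: c_def)
  have sc: "fn s c \<in> carrier ?A" using fn_hom(1)[OF s c] .
  have psc: "fn p (fn s c) = c" using fn_Cmp[OF s c, of p] ps c by (simp add: V_sel)
  \<comment> \<open>With \<open>m = -1\<close>, the element \<open>d\<close> is \<open>a - s(p(a))\<close>, the component of \<open>a\<close> in the kernel.\<close>
  define m where "m = \<ominus>\<^bsub>K\<^esub> \<one>\<^bsub>K\<^esub>"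
  have m: "m \<in> carrier K" by (simp add: m_def)
  define d where "d = a \<oplus>\<^bsub>?A\<^esub> m \<odot>\<^bsub>?A\<^esub> fn s c"
  have dA: "d \<in> carrier ?A" using a sc m by (simp add: d_def)
  have neg: "c \<oplus>\<^bsub>?C\<^esub> m \<odot>\<^bsub>?C\<^esub> c = \<zero>\<^bsub>?C\<^esub>"
    using C.smult_l_minus[of "\<one>\<^bsub>K\<^esub>" c] C.smult_one[OF c] C.M.r_neg[OF c] c unfolding m_def by simp
  have "fn p d = c \<oplus>\<^bsub>?C\<^esub> m \<odot>\<^bsub>?C\<^esub> c"
    using fn_hom(2)[OF p a A.smult_closed[OF m sc]] fn_hom(3)[OF p m sc] psc
    by (simp only: d_def c_def)
  then obtain x where x: "x \<in> carrier X" "fn k x = d"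
    using kernel_surj[OF ker p dA] neg by metis
  have ad: "a = fn s c \<oplus>\<^bsub>?A\<^esub> d"
    using A.smult_l_minus[of "\<one>\<^bsub>K\<^esub>" "fn s c"] A.smult_one[OF sc] A.M.a_lcomm[OF sc a]
      A.M.r_neg[OF sc] a sc unfolding d_def m_def by simp
  have oneC: "\<one>\<^bsub>B\<^esub> \<in> carrier ?C" using B by (simp add: V\<^sub>1_Obj)
  have s1: "fn s \<one>\<^bsub>B\<^esub> \<in> carrier ?A" using fn_hom(1)[OF s oneC] .
  have s1c: "fn s \<one>\<^bsub>B\<^esub> \<otimes>\<^bsub>?A\<^esub> fn s c = fn s c" "fn s c \<otimes>\<^bsub>?A\<^esub> fn s \<one>\<^bsub>B\<^esub> = fn s c"
    using fn_hom(4)[OF s oneC c] fn_hom(4)[OF s c oneC] B c by (simp_all add: V\<^sub>1_Obj)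
  have s1d: "fn s \<one>\<^bsub>B\<^esub> \<otimes>\<^bsub>?A\<^esub> d = d" "d \<otimes>\<^bsub>?A\<^esub> fn s \<one>\<^bsub>B\<^esub> = d"
    using coherent_one_acts_trivially[OF act coh assoc x(1)] x(2) by simp_all
  show "fn s \<one>\<^bsub>B\<^esub> \<otimes>\<^bsub>?A\<^esub> a = a" "a \<otimes>\<^bsub>?A\<^esub> fn s \<one>\<^bsub>B\<^esub> = a"
    using A.mult_add_right[OF sc dA s1] A.mult_add_left[OF sc dA s1] by (simp_all add: ad[symmetric] s1c s1d)
qed

text \<open>The unital algebra that lifts the domain of the point \<open>(p, s)\<close>.\<close>

abbreviation with_one where
  "with_one p s B \<equiv> (src p)\<lparr>one := fn s \<one>\<^bsub>B\<^esub>\<rparr>"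

lemma with_one_Obj:
  assumes act: "relative_action E S B X \<xi>" and coh: "coherent E S B X \<xi>"
    and assoc: "associated_via V S (forget_unit B) X \<xi> p s k"
  shows "with_one p s B \<in> Obj V\<^sub>1" "forget_unit (with_one p s B) = src p"
proof -
  have B: "B \<in> Obj V\<^sub>1" using act by (simp add: relative_action_def E_sel)
  have s: "s \<in> Hom V (forget_unit B) (src p)"
    using assoc by (auto simp: associated_via_def is_point_def Hom_def V_sel)
  have A: "src p \<in> Obj V" using s by (simp add: V_Hom)
  have "fn s \<one>\<^bsub>B\<^esub> \<in> carrier (src p)" using fn_hom(1)[OF s] B by (simp add: V\<^sub>1_Obj)
  then show "with_one p s B \<in> Obj V\<^sub>1"
    using A coherent_point_unital[OF assms] in_variety_one_update[OF _ polys, of "src p"]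
    by (simp add: V\<^sub>1_Obj V_Obj)
  show "forget_unit (with_one p s B) = src p"
    using A by (simp add: forget_unit_def V_Obj)
qed

lemma coherent_point_lifts:
  assumes act: "relative_action E S B X \<xi>" and coh: "coherent E S B X \<xi>"
    and assoc: "associated_via V S (forget_unit B) X \<xi> p s k"
  shows "lifts_point E B p s (Arrow (with_one p s B) (fn p) B) (Arrow B (fn s) (with_one p s B))
    (Idt V (src p))"
proof -
  let ?A = "with_one p s B" and ?C = "forget_unit B"
  have B: "B \<in> Obj V\<^sub>1" using act by (simp add: relative_action_def E_sel)
  note A = with_one_Obj[OF assms]
  have s: "s \<in> Hom V ?C (src p)" and p: "p \<in> Hom V (src p) ?C" and ps: "p \<cdot>\<^bsub>V\<^esub> s = Idt V ?C"
    using assoc by (auto simp: associated_via_def is_point_def Hom_def V_sel)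
  have AV: "src p \<in> Obj V" using s by (simp add: V_Hom)
  note Id = Idt_Hom[OF AV]
  have ps1: "fn p (fn s y) = y" if "y \<in> carrier B" for y
    using fn_Cmp[OF s, of y p] ps that by (simp add: V_sel)
  have hom: "alg_hom K ?A B h \<longleftrightarrow> alg_hom K (src p) B h"
      "alg_hom K B ?A h \<longleftrightarrow> alg_hom K B (src p) h" for h
    by (simp_all add: alg_hom_def)
  have p': "Arrow ?A (fn p) B \<in> Hom V\<^sub>1 ?A B"
    using A B p ps1 by (simp add: V\<^sub>1_Hom hom) (simp add: V_Hom V\<^sub>1_Obj)
  have s': "Arrow B (fn s) ?A \<in> Hom V\<^sub>1 B ?A"
    using A B s by (simp add: V\<^sub>1_Hom hom) (simp add: V_Hom)
  have "Arrow ?A (fn p) B \<cdot>\<^bsub>V\<^sub>1\<^esub> Arrow B (fn s) ?A = Idt V\<^sub>1 B"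
    by (auto simp: V\<^sub>1_sel compose_def ps1 intro!: restrict_ext)
  then have point: "is_point V\<^sub>1 B (Arrow ?A (fn p) B) (Arrow B (fn s) ?A)"
    using p' s' by (simp add: is_point_def V\<^sub>1_sel Hom_def)
  have iso: "is_iso V (Idt V (src p))"
    using Id Cmp_Idt[OF Id] HomD[OF Id] by (auto simp: is_iso_def)
  have Ua_eq: "Ua E (Arrow ?A (fn p) B) = p" "Ua E (Arrow B (fn s) ?A) = s"
    using p s A by (auto simp: E_sel V_Hom intro!: arrow.expand)
  show ?thesis
    unfolding lifts_point_def Ua_eq
    using point iso Id A(2) Cmp_Idt[OF p] Idt_Cmp[OF s] by (simp add: E_sel V_sel V\<^sub>1_sel)
qed

text \<open>A morphism of points commutes with the sections, so it preserves their value at \<open>1\<close>, which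
  is the unit.\<close>

lemma coherent_point_morphism_ideal:
  assumes act1: "relative_action E S B X\<^sub>1 \<xi>\<^sub>1" "coherent E S B X\<^sub>1 \<xi>\<^sub>1"
    and assoc1: "associated_via V S (forget_unit B) X\<^sub>1 \<xi>\<^sub>1 p\<^sub>1 s\<^sub>1 k\<^sub>1"
    and act2: "relative_action E S B X\<^sub>2 \<xi>\<^sub>2" "coherent E S B X\<^sub>2 \<xi>\<^sub>2"
    and assoc2: "associated_via V S (forget_unit B) X\<^sub>2 \<xi>\<^sub>2 p\<^sub>2 s\<^sub>2 k\<^sub>2"
    and mor: "point_morphism V p\<^sub>1 s\<^sub>1 p\<^sub>2 s\<^sub>2 h"
  shows "ideal_point_morphism E B p\<^sub>1 s\<^sub>1 p\<^sub>2 s\<^sub>2 h"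
proof -
  let ?A1 = "with_one p\<^sub>1 s\<^sub>1 B" and ?A2 = "with_one p\<^sub>2 s\<^sub>2 B"
  let ?h = "Arrow ?A1 (fn h) ?A2"
  have B: "B \<in> Obj V\<^sub>1" using act1 by (simp add: relative_action_def E_sel)
  note A1 = with_one_Obj[OF act1 assoc1] and A2 = with_one_Obj[OF act2 assoc2]
  have h: "h \<in> Hom V (src p\<^sub>1) (src p\<^sub>2)" and hp: "p\<^sub>2 \<cdot>\<^bsub>V\<^esub> h = p\<^sub>1" and hs: "h \<cdot>\<^bsub>V\<^esub> s\<^sub>1 = s\<^sub>2"
    using mor by (auto simp: point_morphism_def V_sel)
  have s: "s\<^sub>1 \<in> Hom V (forget_unit B) (src p\<^sub>1)" "s\<^sub>2 \<in> Hom V (forget_unit B) (src p\<^sub>2)"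
    and p: "p\<^sub>1 \<in> Hom V (src p\<^sub>1) (forget_unit B)" "p\<^sub>2 \<in> Hom V (src p\<^sub>2) (forget_unit B)"
    using assoc1 assoc2 by (auto simp: associated_via_def is_point_def Hom_def V_sel)
  have hs': "fn h (fn s\<^sub>1 y) = fn s\<^sub>2 y" if "y \<in> carrier B" for y
    using fn_Cmp[OF s(1), of y h] hs that by simp
  have hp': "fn p\<^sub>2 (fn h y) = fn p\<^sub>1 y" if "y \<in> carrier (src p\<^sub>1)" for y
    using fn_Cmp[OF h, of y p\<^sub>2] hp that by simp
  have "alg_hom K ?A1 ?A2 (fn h)"
    using h by (simp add: V_Hom alg_hom_def)
  then have h': "?h \<in> Hom V\<^sub>1 ?A1 ?A2"
    using A1 A2 h hs' B by (simp add: V\<^sub>1_Hom) (simp add: V_Hom V\<^sub>1_Obj)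
  have "point_morphism V\<^sub>1 (Arrow ?A1 (fn p\<^sub>1) B) (Arrow B (fn s\<^sub>1) ?A1)
      (Arrow ?A2 (fn p\<^sub>2) B) (Arrow B (fn s\<^sub>2) ?A2) ?h"
  proof -
    have "compose (carrier (src p\<^sub>1)) (fn p\<^sub>2) (fn h) = fn p\<^sub>1"
      by (rule extensionalityI[where A = "carrier (src p\<^sub>1)"])
        (use p in \<open>auto simp: V_Hom compose_eq hp'\<close>)
    moreover have "compose (carrier B) (fn h) (fn s\<^sub>1) = fn s\<^sub>2"
      by (rule extensionalityI[where A = "carrier B"])
        (use s in \<open>auto simp: V_Hom compose_eq hs'\<close>)
    ultimately show ?thesis using h' by (simp add: point_morphism_def V\<^sub>1_sel)
  qed
  moreover have "h \<cdot>\<^bsub>V\<^esub> Idt V (src p\<^sub>1) = Idt V (src p\<^sub>2) \<cdot>\<^bsub>V\<^esub> Ua E ?h"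
  proof -
    have "Ua E ?h = h" using h A1 A2 by (auto simp: E_sel V_Hom intro!: arrow.expand)
    then show ?thesis by (simp add: Cmp_Idt[OF h] Idt_Cmp[OF h])
  qed
  ultimately show ?thesis
    unfolding ideal_point_morphism_def E_sel(1,2)
    using mor coherent_point_lifts[OF act1 assoc1] coherent_point_lifts[OF act2 assoc2] by blast
qed

end

theorem theorem6p12:
  fixes K :: "'k ring"
    and \<Phi> :: "(monomial \<Rightarrow> 'k) set"
    and e :: "'k \<times> 'a \<Rightarrow> 'a"
  assumes "field K"
    and "\<Phi> \<subseteq> nonassoc_polys K"
    and "inj_on e (carrier K \<times> UNIV)"
    and "unit_closed TYPE('a) K \<Phi>"
  shows "BAT (unital_context K \<Phi> e)"
proof -
  interpret unit_closed_variety K \<Phi> e by (rule unit_closed_variety.intro) (fact assms)+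
  show ?thesis
    unfolding BAT_def
  proof (intro allI impI conjI)
    fix S assume "is_choice (catV E) S"
    then interpret unit_closed_variety_with_choice K \<Phi> e S
      by (intro unit_closed_variety_with_choice.intro category_with_choice.intro
          category_with_choice_axioms.intro unit_closed_variety_axioms category_laws_axioms)
        (simp add: E_sel)
    show "ideal_action E S B X \<xi>" if "relative_action E S B X \<xi> \<and> coherent E S B X \<xi>" for B X \<xi>
      unfolding ideal_action_def
    proof (intro allI impI)
      fix p s assume "associated (catV E) S (Uo E B) X \<xi> p s"
      then obtain k where k: "associated_via V S (forget_unit B) X \<xi> p s k"
        by (auto simp: associated_def E_sel)
      then have "is_point V (forget_unit B) p s" by (simp add: associated_via_def)
      with coherent_point_lifts[OF conjunct1[OF that] conjunct2[OF that] k]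
      show "ideal_point E B p s"
        unfolding ideal_point_def E_sel(1,3) by blast
    qed
    show "ideal_action_morphism E S B X\<^sub>1 \<xi>\<^sub>1 X\<^sub>2 \<xi>\<^sub>2 f"
      if "relative_action E S B X\<^sub>1 \<xi>\<^sub>1 \<and> coherent E S B X\<^sub>1 \<xi>\<^sub>1 \<and>
        relative_action E S B X\<^sub>2 \<xi>\<^sub>2 \<and> coherent E S B X\<^sub>2 \<xi>\<^sub>2 \<and>
        action_morphism (catV E) S (Uo E B) X\<^sub>1 \<xi>\<^sub>1 X\<^sub>2 \<xi>\<^sub>2 f" for B X\<^sub>1 \<xi>\<^sub>1 X\<^sub>2 \<xi>\<^sub>2 f
      unfolding ideal_action_morphism_def E_sel(1,3)
      using that coherent_point_morphism_ideal by blast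
  qed
qed

end
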